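(* Let $m\ge 0$ and $n>m$ be integers, let $K>0$ and $\alpha\ge 0$, and let $z=(z_1,\dots,z_m)\in\mathbb{C}^m$ be a list of complex numbers closed under complex conjugation (with multiplicity) such that $z_i\notin[0,+\infty)$ for all $i$. Write $$B'(s)=K\prod_{i=1}^m(s-z_i-\alpha)=b'_0s^n+b'_1s^{n-1}+\dots+b'_n,\qquad \tilde{B'}(s)=\sum_{i=1}^n\frac{b'_i\,s^{n-i}}{(i-1)!}$$ (so $b'_i=0$ for $0\le i\le n-m-1$). Then the following are equivalent: (a) there exist $p=(p_1,\dots,p_n)\in\mathbb{C}^n$, closed under complex conjugation (with multiplicity), with $p_i\neq z_j$ for all $i,j$, such that $H(s)=K\prod_{i=1}^m(s-z_i)/\prod_{i=1}^n(s-p_i)$ is stable and externally positive with decay rate $\sigma(H)<-\alpha$; (b) the polynomial $\tilde{B'}$ has no real non-negative roots.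
   Context: All transfer functions have real coefficients. The transfer function $H(s)=K\prod_{i=1}^m(s-z_i)/\prod_{i=1}^n(s-p_i)$ is called stable if $\operatorname{Re}(p_i)<0$ for all $i$. Its decay rate is its pole abscissa $\sigma(H)=\max_i\operatorname{Re}(p_i)$. It is called externally positive if its impulse response $h(t)=\mathfrak{L}^{-1}\{H(s)\}$ (inverse Laplace transform) satisfies $h(t)\ge 0$ for all $t\in[0,+\infty)$. For strictly proper $H$ ($n>m$), $h$ is the continuous function on $[0,\infty)$ with Laplace transform $H$. *)

theory Defs
  imports "HOL-Analysis.Analysis" "HOL-Library.Multiset" "HOL-Computational_Algebra.Polynomial"
begin

text \<open>A transfer function is given by its gain, its zeros and its poles,
  both listed with multiplicity.\<close>

datatype transfer_function =
  Transfer_Function (gain: real) (zeros: "complex list") (poles: "complex list")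

definition tf_eval :: "transfer_function \<Rightarrow> complex \<Rightarrow> complex" where
  "tf_eval H s = complex_of_real (gain H) * (\<Prod>w\<leftarrow>zeros H. s - w) / (\<Prod>w\<leftarrow>poles H. s - w)"

definition conj_closed :: "complex list \<Rightarrow> bool" where
  "conj_closed ws \<longleftrightarrow> mset (map cnj ws) = mset ws"

definition stable_tf :: "transfer_function \<Rightarrow> bool" where
  "stable_tf H \<longleftrightarrow> (\<forall>w\<in>set (poles H). Re w < 0)"

text \<open>Only meaningful when there is at least one pole.\<close>

definition decay_rate :: "transfer_function \<Rightarrow> real" where
  "decay_rate H = Max (Re ` set (poles H))"

definition has_laplace_transform :: "(real \<Rightarrow> real) \<Rightarrow> (complex \<Rightarrow> complex) \<Rightarrow> bool" where
  "has_laplace_transform h F \<longleftrightarrow>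
     (\<exists>c::real. \<forall>s. Re s > c \<longrightarrow>
        ((\<lambda>t. exp (- s * complex_of_real t) * complex_of_real (h t)) has_integral F s) {0..})"

text \<open>Intended for strictly proper transfer functions with real coefficients. There \<open>h\<close> exists
  and its values on \<open>[0, \<infinity>)\<close> are uniquely determined (by continuity); its values at
  negative arguments are unconstrained.\<close>

definition is_impulse_response :: "transfer_function \<Rightarrow> (real \<Rightarrow> real) \<Rightarrow> bool" where
  "is_impulse_response H h \<longleftrightarrow> continuous_on {0..} h \<and> has_laplace_transform h (tf_eval H)"

definition externally_positive :: "transfer_function \<Rightarrow> bool" where
  "externally_positive H \<longleftrightarrow> (\<exists>h. is_impulse_response H h \<and> (\<forall>t\<ge>0. h t \<ge> 0))"

definition B_shift :: "real \<Rightarrow> real \<Rightarrow> complex list \<Rightarrow> complex poly" where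
  "B_shift K \<alpha> z = smult (complex_of_real K) (\<Prod>w\<leftarrow>z. [:- w - complex_of_real \<alpha>, 1:])"

text \<open>Coefficients are indexed from the top: with \<open>B = b\<^sub>0 s\<^sup>n + \<dots> + b\<^sub>n\<close>, the number
  \<open>b\<^sub>i\<close> is \<open>coeff B (n - i)\<close>. The coefficient \<open>b\<^sub>0\<close> is not used.\<close>

definition poly_tilde :: "nat \<Rightarrow> complex poly \<Rightarrow> complex poly" where
  "poly_tilde n B = (\<Sum>i=1..n. monom (coeff B (n - i) / fact (i - 1)) (n - i))"

end

theory Submission
  imports Defs "HOL-Complex_Analysis.Complex_Analysis"
begin

text \<open>Write \<open>B(s) = K \<Prod>(s - z\<^sub>i - a)\<close> with coefficients \<open>b\<^sub>j(a)\<close>; then \<open>B(s) / s\<^sup>n\<close> has the inverse Laplace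
  transform \<open>t\<^sup>n\<^sup>-\<^sup>1 U(a, 1/t)\<close>, where \<open>U(a, \<cdot>)\<close> is the polynomial of statement (b) for \<open>a = \<alpha>\<close>.

  (b) to (a): all poles are placed at \<open>-a\<close> with \<open>a\<close> slightly larger than \<open>\<alpha>\<close>; the impulse response is
  \<open>e\<^sup>-\<^sup>a\<^sup>t t\<^sup>n\<^sup>-\<^sup>1 U(a, 1/t)\<close>, and positivity of \<open>U(\<alpha>, \<cdot>)\<close> on the half-line is stable under perturbation of \<open>\<alpha>\<close>.

  (a) to (b): a nonnegative impulse response makes \<open>H\<close> completely monotone to the right of its poles.
  For \<open>a < -\<sigma>(H)\<close> the factors \<open>(s - p\<^sub>i) / (s + a)\<close>, taken in conjugate pairs, are completely monotone as
  well, hence so is \<open>K \<Prod>(s - z\<^sub>i) / (s + a)\<^sup>n\<close>, and Post--Widder inversion gives \<open>U(a, y) \<ge> 0\<close>. This holds for all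
  \<open>a\<close> near \<open>\<alpha>\<close>, so at a zero \<open>y > 0\<close> of \<open>U(\<alpha>, \<cdot>)\<close> also \<open>\<partial>U/\<partial>a\<close> vanishes; but there this derivative is
  a negative multiple of the integral of \<open>t\<^sup>n\<^sup>-\<^sup>1 U(\<alpha>, 1/t)\<close> over \<open>[0, 1/y]\<close>.
  And \<open>U(\<alpha>, 0) = 0\<close> would mean \<open>H(-\<alpha>) = 0\<close>, whence \<open>H = 0\<close> on \<open>[-\<alpha>, \<infinity>)\<close> because \<open>H\<close> is decreasing.\<close>

section \<open>Laplace transforms of exponential polynomials\<close>

text \<open>The truncations of \<open>f\<close> to \<open>{a..a + n}\<close> obey the ordinary
  fundamental theorem and are dominated by \<open>g\<close>, so dominated convergence carries both
  sides to the limit.\<close>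

lemma has_integral_atLeast_FTC:
  fixes f F :: "real \<Rightarrow> 'a::euclidean_space"
  assumes deriv: "\<And>t. t \<ge> a \<Longrightarrow> (F has_vector_derivative f t) (at t)"
    and bound: "\<And>t. t \<ge> a \<Longrightarrow> norm (f t) \<le> g t" and g: "g integrable_on {a..}"
    and lim: "(F \<longlongrightarrow> L) at_top"
  shows "(f has_integral (L - F a)) {a..}"
proof -
  define fn where "fn = (\<lambda>n t. if t \<in> {a..a + real n} then f t else 0)"
  have int: "(fn n has_integral (F (a + real n) - F a)) {a..}" for n
  proof -
    have "(f has_integral (F (a + real n) - F a)) {a..a + real n}"
      by (rule fundamental_theorem_of_calculus) (auto intro: has_vector_derivative_at_within deriv)
    then show ?thesis
      unfolding fn_def by (subst has_integral_restrict) auto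
  qed
  have bd: "norm (fn n t) \<le> g t" if "t \<in> {a..}" for n t
    using bound[of t] that norm_ge_zero[of "f t"] by (auto simp: fn_def simp del: norm_ge_zero)
  have ptw: "(\<lambda>n. fn n t) \<longlonglongrightarrow> f t" if "t \<in> {a..}" for t
  proof (rule tendsto_eventually)
    obtain N where "t - a \<le> real N"
      using real_arch_simple by blast
    then show "\<forall>\<^sub>F n in sequentially. fn n t = f t"
      using that by (intro eventually_sequentiallyI[of N]) (auto simp: fn_def)
  qed
  have fn_int: "fn n integrable_on {a..}" for n
    using int by blast
  note dc = dominated_convergence[OF fn_int g bd ptw]
  have "(\<lambda>n. F (a + real n) - F a) \<longlonglongrightarrow> L - F a"
    by (intro tendsto_diff tendsto_const filterlim_compose[OF lim]) real_asymp
  moreover have "(\<lambda>n. F (a + real n) - F a) \<longlonglongrightarrow> integral {a..} f"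
    using dc(2) integral_unique[OF int] by simp
  ultimately have "integral {a..} f = L - F a"
    using LIMSEQ_unique by blast
  then show ?thesis
    using dc(1) by (metis integrable_integral)
qed

text \<open>One term of the exponential series at \<open>r * t / 2\<close> is at most the whole
  series. Half of the decay absorbs the power, the other half remains.\<close>

lemma power_times_exp_bound:
  fixes r t :: real
  assumes "r > 0" "t \<ge> 0"
  shows "t ^ k * exp (- r * t) \<le> (fact k * (2 / r) ^ k) * exp (- (r / 2) * t)"
proof -
  define x where "x = r / 2 * t"
  have "x \<ge> 0" using assms by (simp add: x_def)
  then have "(\<Sum>n\<in>{k}. inverse (fact n) * x ^ n) \<le> (\<Sum>n. inverse (fact n) * x ^ n)"
    by (intro sum_le_suminf summable_exp) auto
  then have "x ^ k \<le> fact k * exp x"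
    by (simp add: exp_def field_simps)
  then have "(2 / r) ^ k * x ^ k \<le> (2 / r) ^ k * (fact k * exp x)"
    using assms by (intro mult_left_mono) auto
  moreover have "(2 / r) ^ k * x ^ k = t ^ k"
    using assms by (simp add: x_def flip: power_mult_distrib)
  ultimately have "t ^ k \<le> fact k * (2 / r) ^ k * exp (r / 2 * t)"
    by (simp add: x_def mult_ac)
  then have "t ^ k * exp (- r * t) \<le> fact k * (2 / r) ^ k * exp (r / 2 * t) * exp (- r * t)"
    by (intro mult_right_mono) auto
  also have "\<dots> = fact k * (2 / r) ^ k * exp (- (r / 2) * t)"
    by (simp add: mult.assoc flip: exp_add)
  finally show ?thesis .
qed

lemma tendsto_power_times_exp:
  fixes w :: complex
  assumes "Re w > 0"
  shows "((\<lambda>t. of_real t ^ k * exp (- w * of_real t)) \<longlongrightarrow> 0) at_top"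
proof (rule tendsto_norm_zero_cancel)
  have "((\<lambda>t. exp (- (Re w / 2) * t)) \<longlongrightarrow> 0) at_top"
    using assms by real_asymp
  then have bound_lim: "((\<lambda>t. (fact k * (2 / Re w) ^ k) * exp (- (Re w / 2) * t)) \<longlongrightarrow> 0) at_top"
    by (rule tendsto_mult_right_zero)
  have "((\<lambda>t. t ^ k * exp (- Re w * t)) \<longlongrightarrow> 0) at_top"
  proof (rule tendsto_sandwich[OF _ _ tendsto_const bound_lim])
    show "\<forall>\<^sub>F t in at_top. t ^ k * exp (- Re w * t) \<le> (fact k * (2 / Re w) ^ k) * exp (- (Re w / 2) * t)"
      using eventually_ge_at_top[of 0] by eventually_elim (rule power_times_exp_bound[OF assms])
    show "\<forall>\<^sub>F t::real in at_top. 0 \<le> t ^ k * exp (- Re w * t)"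
      using eventually_ge_at_top[of 0] by eventually_elim simp
  qed
  moreover have "\<forall>\<^sub>F t in at_top. t ^ k * exp (- Re w * t) = norm (of_real t ^ k * exp (- w * of_real t))"
    using eventually_ge_at_top[of 0] by eventually_elim (simp add: norm_mult norm_power)
  ultimately show "((\<lambda>t. norm (of_real t ^ k * exp (- w * of_real t))) \<longlongrightarrow> 0) at_top"
    by (rule Lim_transform_eventually)
qed

text \<open>Integration by parts, as an induction on \<open>k\<close>;
  \<open>power_times_exp_bound\<close> supplies the integrable majorants.\<close>

lemma laplace_power:
  fixes w :: complex
  assumes "Re w > 0"
  shows "((\<lambda>t. of_real t ^ k * exp (- w * of_real t)) has_integral (fact k / w ^ Suc k)) {0..}"
proof (induction k)
  have w: "w \<noteq> 0" using assms by auto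
  define r where "r = Re w"
  have r: "r > 0" using assms by (simp add: r_def)
  have nrm: "norm (of_real t ^ k * exp (- w * of_real t)) = t ^ k * exp (- r * t)" if "t \<ge> 0" for t k
    using that by (simp add: norm_mult norm_power r_def)
  have expint: "(\<lambda>t. C * exp (- (r / 2) * t)) integrable_on {0..}" for C
    using integrable_on_exp_minus_to_infinity[of "r / 2" 0] r by (intro integrable_on_mult_right) simp
  {
    case 0
    have "((\<lambda>t. exp (- w * of_real t)) has_integral (0 - (- exp (- w * of_real 0) / w))) {0..}"
    proof (rule has_integral_atLeast_FTC)
      show "((\<lambda>t. - exp (- w * of_real t) / w) has_vector_derivative exp (- w * of_real t)) (at t)" for t
        using w by (auto intro!: derivative_eq_intros has_vector_derivative_real_field)
      show "norm (exp (- w * of_real t)) \<le> 1 * exp (- (r / 2) * t)" if "t \<ge> 0" for t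
        using that r by (simp add: r_def[symmetric])
      show "((\<lambda>t. - exp (- w * of_real t) / w) \<longlongrightarrow> 0) at_top"
        using tendsto_mult[OF tendsto_power_times_exp[OF assms, of 0] tendsto_const[of "- (1 / w)"]] by simp
    qed (rule expint)
    then show ?case by simp
  next
    case (Suc k)
    let ?C = "\<lambda>k. fact k * (2 / r) ^ k"
    \<comment> \<open>\<open>?f\<close> is the derivative of
      \<open>- (t ^ Suc k * exp (- w * t)) / w\<close>, which vanishes at 0 and at infinity. So
      \<open>?f\<close> integrates to 0, and adding \<open>Suc k / w\<close> times the induction
      hypothesis isolates the wanted integral.\<close>
    let ?f = "\<lambda>t. of_real t ^ Suc k * exp (- w * of_real t) - of_nat (Suc k) / w * (of_real t ^ k * exp (- w * of_real t))"
    have "(?f has_integral (0 - (- (of_real 0 ^ Suc k * exp (- w * of_real 0)) / w))) {0..}"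
    proof (rule has_integral_atLeast_FTC)
      show "((\<lambda>t. - (of_real t ^ Suc k * exp (- w * of_real t)) / w) has_vector_derivative ?f t) (at t)" for t
        using w power_minus_mult[of k "complex_of_real t"]
        by (fastforce intro!: derivative_eq_intros has_vector_derivative_real_field simp: field_simps)
      show "norm (?f t) \<le> (?C (Suc k) + real (Suc k) / norm w * ?C k) * exp (- (r / 2) * t)" if "t \<ge> 0" for t
      proof -
        have "norm (?f t) \<le> norm (of_real t ^ Suc k * exp (- w * of_real t))
            + norm (of_nat (Suc k) / w * (of_real t ^ k * exp (- w * of_real t)))"
          by (rule norm_triangle_ineq4)
        also have "\<dots> = t ^ Suc k * exp (- r * t) + real (Suc k) / norm w * (t ^ k * exp (- r * t))"
          by (subst norm_mult[of "of_nat (Suc k) / w"], subst (1 2) nrm[OF that]) (simp add: norm_divide del: of_nat_Suc)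
        also have "\<dots> \<le> ?C (Suc k) * exp (- (r / 2) * t) + real (Suc k) / norm w * (?C k * exp (- (r / 2) * t))"
          by (intro add_mono mult_left_mono power_times_exp_bound r that) auto
        finally show ?thesis by (simp only: distrib_right mult.assoc)
      qed
      show "((\<lambda>t. - (of_real t ^ Suc k * exp (- w * of_real t)) / w) \<longlongrightarrow> 0) at_top"
        using tendsto_mult[OF tendsto_power_times_exp[OF assms, of "Suc k"] tendsto_const[of "- (1 / w)"]] by simp
    qed (rule expint)
    then have "(?f has_integral 0) {0..}"
      by simp
    from has_integral_add[OF this has_integral_mult_right[OF Suc, of "of_nat (Suc k) / w"]]
    show ?case
      using w by (simp add: field_simps)
  }
qed

section \<open>Completely monotone functions\<close>

text \<open>Complete monotonicity on a real half-line, expressed by complex derivatives so that the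
  Leibniz rule and Taylor series of holomorphic functions apply. Membership in the nonnegative reals
  also says that \<open>f\<close> is real on the half-line.\<close>

definition completely_monotone_beyond :: "real \<Rightarrow> (complex \<Rightarrow> complex) \<Rightarrow> bool" where
  "completely_monotone_beyond a f \<longleftrightarrow> f holomorphic_on {s. Re s > a} \<and>
     (\<forall>k x. x > a \<longrightarrow> (- 1) ^ k * (deriv ^^ k) f (of_real x) \<in> \<real>\<^sub>\<ge>\<^sub>0)"

lemma completely_monotone_beyondD:
  assumes "completely_monotone_beyond a f"
  shows "f holomorphic_on {s. Re s > a}"
    and "\<And>x k. x > a \<Longrightarrow> (- 1) ^ k * (deriv ^^ k) f (of_real x) \<in> \<real>\<^sub>\<ge>\<^sub>0"
  using assms by (auto simp: completely_monotone_beyond_def)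

lemma completely_monotone_beyond_cong:
  assumes f: "completely_monotone_beyond a f" and eq: "\<And>s. Re s > a \<Longrightarrow> f s = g s"
  shows "completely_monotone_beyond a g"
proof -
  have hol: "g holomorphic_on {s. Re s > a}"
    by (rule holomorphic_transform[OF completely_monotone_beyondD(1)[OF f]]) (simp add: eq)
  moreover have "(deriv ^^ k) f (of_real x) = (deriv ^^ k) g (of_real x)" if "x > a" for k x
    using that eq
    by (intro higher_deriv_transform_within_open[OF completely_monotone_beyondD(1)[OF f] hol])
       (auto simp: open_halfspace_Re_gt)
  ultimately show ?thesis
    using completely_monotone_beyondD(2)[OF f] by (auto simp: completely_monotone_beyond_def)
qed

lemma completely_monotone_beyond_const:
  assumes "c \<in> \<real>\<^sub>\<ge>\<^sub>0"
  shows "completely_monotone_beyond a (\<lambda>_. c)"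
  using assms by (auto simp: completely_monotone_beyond_def)

lemma completely_monotone_beyond_add:
  assumes f: "completely_monotone_beyond a f" and g: "completely_monotone_beyond a g"
  shows "completely_monotone_beyond a (\<lambda>s. f s + g s)"
  unfolding completely_monotone_beyond_def
proof (intro conjI allI impI)
  note hol = completely_monotone_beyondD(1)[OF f] completely_monotone_beyondD(1)[OF g]
  show "(\<lambda>s. f s + g s) holomorphic_on {s. a < Re s}"
    using hol by (intro holomorphic_intros)
  fix k and x :: real assume x: "a < x"
  have "(deriv ^^ k) (\<lambda>s. f s + g s) (of_real x) = (deriv ^^ k) f (of_real x) + (deriv ^^ k) g (of_real x)"
    using x by (intro higher_deriv_add[OF hol]) (auto simp: open_halfspace_Re_gt)
  then show "(- 1) ^ k * (deriv ^^ k) (\<lambda>s. f s + g s) (of_real x) \<in> \<real>\<^sub>\<ge>\<^sub>0"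
    using completely_monotone_beyondD(2)[OF f x, of k] completely_monotone_beyondD(2)[OF g x, of k]
    by (simp add: distrib_left)
qed

lemma sum_nonneg_Reals: "(\<And>i. i \<in> I \<Longrightarrow> f i \<in> \<real>\<^sub>\<ge>\<^sub>0) \<Longrightarrow> sum f I \<in> \<real>\<^sub>\<ge>\<^sub>0"
  by (induction I rule: infinite_finite_induct) auto

text \<open>In the Leibniz rule \<open>(- 1) ^ k\<close> splits as
  \<open>(- 1) ^ i * (- 1) ^ (k - i)\<close>, so each summand becomes a product of nonnegative
  numbers.\<close>

lemma completely_monotone_beyond_mult:
  assumes f: "completely_monotone_beyond a f" and g: "completely_monotone_beyond a g"
  shows "completely_monotone_beyond a (\<lambda>s. f s * g s)"
  unfolding completely_monotone_beyond_def
proof (intro conjI allI impI)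
  note hol = completely_monotone_beyondD(1)[OF f] completely_monotone_beyondD(1)[OF g]
  show "(\<lambda>s. f s * g s) holomorphic_on {s. a < Re s}"
    using hol by (intro holomorphic_intros)
  fix k and x :: real assume x: "a < x"
  let ?F = "\<lambda>i. (- 1) ^ i * (deriv ^^ i) f (of_real x)" and ?G = "\<lambda>i. (- 1) ^ i * (deriv ^^ i) g (of_real x)"
  have leibniz: "(deriv ^^ k) (\<lambda>s. f s * g s) (of_real x) =
      (\<Sum>i = 0..k. of_nat (k choose i) * (deriv ^^ i) f (of_real x) * (deriv ^^ (k - i)) g (of_real x))"
    using x by (intro higher_deriv_mult[OF hol]) (auto simp: open_halfspace_Re_gt)
  have "(- 1) ^ k * (deriv ^^ k) (\<lambda>s. f s * g s) (of_real x) =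
      (\<Sum>i = 0..k. of_nat (k choose i) * (?F i * ?G (k - i)))"
    unfolding leibniz sum_distrib_left
  proof (rule sum.cong)
    fix i assume "i \<in> {0..k}"
    then have "(- 1 :: complex) ^ k = (- 1) ^ i * (- 1) ^ (k - i)"
      by (simp flip: power_add)
    then show "(- 1) ^ k * (of_nat (k choose i) * (deriv ^^ i) f (of_real x) * (deriv ^^ (k - i)) g (of_real x))
        = of_nat (k choose i) * (?F i * ?G (k - i))"
      by (simp add: mult_ac)
  qed simp
  also have "\<dots> \<in> \<real>\<^sub>\<ge>\<^sub>0"
    by (intro sum_nonneg_Reals nonneg_Reals_mult_I nonneg_Reals_of_nat_I
        completely_monotone_beyondD(2)[OF f x] completely_monotone_beyondD(2)[OF g x])
  finally show "(- 1) ^ k * (deriv ^^ k) (\<lambda>s. f s * g s) (of_real x) \<in> \<real>\<^sub>\<ge>\<^sub>0" .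
qed

text \<open>Differentiating \<open>1 / (s - c) ^ (i + k)\<close> contributes the factor
  \<open>- (i + k)\<close>, and the rising factorial collects these factors.\<close>

lemma higher_deriv_inverse_power:
  fixes z c :: complex
  assumes "z \<noteq> c"
  shows "(deriv ^^ k) (\<lambda>s. 1 / (s - c) ^ i) z = (- 1) ^ k * pochhammer (of_nat i) k / (z - c) ^ (i + k)"
  using assms
proof (induction k arbitrary: z)
  case (Suc k)
  have "deriv ((deriv ^^ k) (\<lambda>s. 1 / (s - c) ^ i)) z
      = deriv (\<lambda>s. (- 1) ^ k * pochhammer (of_nat i) k / (s - c) ^ (i + k)) z"
    using Suc.IH t1_space_nhds[OF Suc.prems] by (intro deriv_cong_ev) (auto elim: eventually_mono)
  also have "\<dots> = (- 1) ^ Suc k * pochhammer (of_nat i) (Suc k) / (z - c) ^ (i + Suc k)"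
  proof (rule DERIV_imp_deriv)
    \<comment> \<open>For \<open>n = 0\<close>, where \<open>n - 1\<close> is truncated, both sides
      are 0.\<close>
    have aux: "inverse ((z - c) ^ n) * (of_nat n * (z - c) ^ (n - 1)) * inverse ((z - c) ^ n)
        = of_nat n / (z - c) ^ Suc n" for n
      using Suc.prems by (cases n) (simp_all add: divide_inverse power_inverse)
    have "((\<lambda>s. (- 1) ^ k * pochhammer (of_nat i) k * inverse ((s - c) ^ (i + k))) has_field_derivative
        (- 1) ^ k * pochhammer (of_nat i) k *
        (- (inverse ((z - c) ^ (i + k)) * (of_nat (i + k) * (z - c) ^ (i + k - 1)) * inverse ((z - c) ^ (i + k))))) (at z)"
      using Suc.prems by (auto intro!: derivative_eq_intros)
    also have "(- 1) ^ k * pochhammer (of_nat i) k *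
        (- (inverse ((z - c) ^ (i + k)) * (of_nat (i + k) * (z - c) ^ (i + k - 1)) * inverse ((z - c) ^ (i + k))))
        = (- 1) ^ Suc k * pochhammer (of_nat i) (Suc k) / (z - c) ^ (i + Suc k)"
      by (subst aux) (simp add: pochhammer_Suc divide_inverse mult_ac)
    finally show "((\<lambda>s. (- 1) ^ k * pochhammer (of_nat i) k / (s - c) ^ (i + k)) has_field_derivative
        (- 1) ^ Suc k * pochhammer (of_nat i) (Suc k) / (z - c) ^ (i + Suc k)) (at z)"
      by (simp add: divide_inverse)
  qed
  finally show ?case by simp
qed simp

lemma completely_monotone_beyond_inverse:
  "completely_monotone_beyond a (\<lambda>s. 1 / (s - of_real a))"
  unfolding completely_monotone_beyond_def
proof (intro conjI allI impI)
  show "(\<lambda>s. 1 / (s - of_real a)) holomorphic_on {s. a < Re s}"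
    by (auto intro!: holomorphic_intros)
  fix k and x :: real assume x: "a < x"
  have sgn: "(- 1) ^ k * ((- 1) ^ k * y / z) = y / z" for y z :: complex
    by (simp add: mult.assoc[symmetric] flip: power_mult_distrib)
  from x have "(- 1) ^ k * (deriv ^^ k) (\<lambda>s. 1 / (s - complex_of_real a)) (of_real x) =
      of_real (fact k / (x - a) ^ (1 + k))"
    using higher_deriv_inverse_power[of "of_real x" "of_real a" k 1]
    by (simp add: sgn pochhammer_fact[symmetric])
  then show "(- 1) ^ k * (deriv ^^ k) (\<lambda>s. 1 / (s - complex_of_real a)) (of_real x) \<in> \<real>\<^sub>\<ge>\<^sub>0"
    using x by (simp only: nonneg_Reals_of_real_iff) simp
qed

text \<open>With \<open>u = 1 / (s - a)\<close>, a real \<open>w\<close> gives the factor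
  \<open>1 + (a - w) * u\<close>, and a conjugate pair gives
  \<open>1 + 2 * (a - Re w) * u + ((a - Re w)^2 + (Im w)^2) * u^2\<close>. The coefficients are
  nonnegative because \<open>Re w \<le> a\<close>. Induction on the size allows one or two elements
  to be removed at a time.\<close>

lemma completely_monotone_beyond_prod_conj:
  assumes "image_mset cnj M = M" "\<And>w. w \<in># M \<Longrightarrow> Re w \<le> a"
  shows "completely_monotone_beyond a (\<lambda>s. \<Prod>w\<in>#M. (s - w) / (s - of_real a))"
  using assms
proof (induction "size M" arbitrary: M rule: less_induct)
  case less
  let ?u = "\<lambda>s. 1 / (s - complex_of_real a)"
  note u = completely_monotone_beyond_inverse[of a]
  have nz: "s - of_real a \<noteq> 0" if "Re s > a" for s
    using that by auto
  show ?case
  proof (cases "M = {#}")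
    case True
    then show ?thesis by (simp add: completely_monotone_beyond_const)
  next
    case False
    then obtain w where w: "w \<in># M" by blast
    then have Rew: "Re w \<le> a" using less.prems by auto
    define N where "N = M - {#w#}"
    have M: "M = add_mset w N" using w by (simp add: N_def)
    show ?thesis
    proof (cases "cnj w = w")
      case True
      then obtain r where r: "w = of_real r" by (metis Reals_cnj_iff Reals_cases)
      have "image_mset cnj N = N" using less.prems(1) True by (simp add: M)
      then have "completely_monotone_beyond a (\<lambda>s. \<Prod>w\<in>#N. (s - w) / (s - of_real a))"
        using less.prems(2) by (intro less.hyps) (auto simp: M)
      moreover have "completely_monotone_beyond a (\<lambda>s. 1 + of_real (a - r) * ?u s)"
        using Rew r by (intro completely_monotone_beyond_add completely_monotone_beyond_mult u
            completely_monotone_beyond_const) (auto simp del: of_real_diff)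
      ultimately have "completely_monotone_beyond a
          (\<lambda>s. (1 + of_real (a - r) * ?u s) * (\<Prod>w\<in>#N. (s - w) / (s - of_real a)))"
        by (rule completely_monotone_beyond_mult[rotated])
      then show ?thesis
        by (rule completely_monotone_beyond_cong) (use nz in \<open>auto simp: M r field_simps\<close>)
    next
      case False
      have "cnj w \<in># M" using w less.prems(1) by (metis image_eqI set_image_mset)
      then have "cnj w \<in># N" using False by (simp add: M)
      define L where "L = N - {#cnj w#}"
      have N: "N = add_mset (cnj w) L" using \<open>cnj w \<in># N\<close> by (simp add: L_def)
      have "image_mset cnj L = L" using less.prems(1) by (simp add: M N add_mset_commute)
      then have "completely_monotone_beyond a (\<lambda>s. \<Prod>w\<in>#L. (s - w) / (s - of_real a))"
        using less.prems(2) by (intro less.hyps) (auto simp: M N)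
      moreover have "completely_monotone_beyond a
          (\<lambda>s. 1 + of_real (2 * (a - Re w)) * ?u s + of_real ((a - Re w)\<^sup>2 + (Im w)\<^sup>2) * (?u s * ?u s))"
        using Rew by (intro completely_monotone_beyond_add completely_monotone_beyond_mult u
            completely_monotone_beyond_const) (simp_all only: nonneg_Reals_of_real_iff nonneg_Reals_one_I, simp_all)
      ultimately have "completely_monotone_beyond a
          (\<lambda>s. (1 + of_real (2 * (a - Re w)) * ?u s + of_real ((a - Re w)\<^sup>2 + (Im w)\<^sup>2) * (?u s * ?u s))
            * (\<Prod>w\<in>#L. (s - w) / (s - of_real a)))"
        by (rule completely_monotone_beyond_mult[rotated])
      then show ?thesis
      proof (rule completely_monotone_beyond_cong)
        fix s assume "Re s > a"
        then have "s - of_real a \<noteq> 0" by (rule nz)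
        have "(s - w) * (s - cnj w) = (s - of_real a)\<^sup>2 + of_real (2 * (a - Re w)) * (s - of_real a)
            + of_real ((a - Re w)\<^sup>2 + (Im w)\<^sup>2)"
          by (auto simp: complex_eq_iff power2_eq_square algebra_simps)
        moreover have "1 + p * (1 / u) + q * (1 / u * (1 / u)) = (u\<^sup>2 + p * u + q) / (u * u)"
          if "u \<noteq> 0" for u p q :: complex
          using that by (simp add: field_simps power2_eq_square)
        ultimately have "1 + of_real (2 * (a - Re w)) * ?u s + of_real ((a - Re w)\<^sup>2 + (Im w)\<^sup>2) * (?u s * ?u s)
            = ((s - w) / (s - of_real a)) * ((s - cnj w) / (s - of_real a))"
          using \<open>s - of_real a \<noteq> 0\<close> by (simp only: times_divide_times_eq)
        then show "(1 + of_real (2 * (a - Re w)) * ?u s + of_real ((a - Re w)\<^sup>2 + (Im w)\<^sup>2) * (?u s * ?u s))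
            * (\<Prod>w\<in>#L. (s - w) / (s - of_real a)) = (\<Prod>w\<in>#M. (s - w) / (s - of_real a))"
          by (simp add: M N mult.assoc)
      qed
    qed
  qed
qed

section \<open>Finite differences and Laplace transforms of nonnegative functions\<close>

definition forward_difference :: "real \<Rightarrow> (real \<Rightarrow> real) \<Rightarrow> real \<Rightarrow> real" where
  "forward_difference d f x = f (x + d) - f x"

text \<open>The induction hypothesis is applied to the sequence of once-differenced derivatives,
  which is why \<open>D\<close> stays arbitrary. The mean value theorem then turns the remaining
  difference into a derivative.\<close>

lemma forward_difference_funpow_mean_value:
  fixes D :: "nat \<Rightarrow> real \<Rightarrow> real"
  assumes "d > 0" "x > c"
    and "\<And>k y. y > c \<Longrightarrow> (D k has_real_derivative D (Suc k) y) (at y)"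
  shows "\<exists>\<xi>\<ge>x. \<xi> \<le> x + k * d \<and> (forward_difference d ^^ k) (D 0) x = d ^ k * D k \<xi>"
  using assms(3)
proof (induction k arbitrary: D)
  case (Suc k)
  have "\<exists>\<xi>\<ge>x. \<xi> \<le> x + k * d \<and>
      (forward_difference d ^^ k) (forward_difference d (D 0)) x = d ^ k * forward_difference d (D k) \<xi>"
    using Suc.prems \<open>d > 0\<close>
    by (intro Suc.IH[of "\<lambda>k. forward_difference d (D k)"])
       (auto simp: forward_difference_def[abs_def] intro!: derivative_eq_intros DERIV_shift[THEN iffD1])
  then obtain \<xi> where \<xi>: "\<xi> \<ge> x" "\<xi> \<le> x + k * d"
    "(forward_difference d ^^ k) (forward_difference d (D 0)) x = d ^ k * forward_difference d (D k) \<xi>"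
    by blast
  have "\<exists>z>\<xi>. z < \<xi> + d \<and> D k (\<xi> + d) - D k \<xi> = (\<xi> + d - \<xi>) * D (Suc k) z"
    using \<xi>(1) assms(1,2) by (intro MVT2 Suc.prems) auto
  then obtain z where z: "z > \<xi>" "z < \<xi> + d" "D k (\<xi> + d) - D k \<xi> = d * D (Suc k) z"
    by auto
  have "(forward_difference d ^^ Suc k) (D 0) x = d ^ Suc k * D (Suc k) z"
    using \<xi>(3) z(3) by (simp add: funpow_Suc_right forward_difference_def del: funpow.simps)
  moreover have "z \<ge> x" "z \<le> x + Suc k * d"
    using z \<xi> by (auto simp: algebra_simps)
  ultimately show ?case by blast
qed (use assms in auto)

text \<open>Replacing \<open>s\<close> by \<open>s + d\<close> multiplies the integrand by
  \<open>exp (- d * t)\<close>, so each difference contributes a factor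
  \<open>exp (- d * t) - 1\<close>.\<close>

lemma forward_difference_laplace:
  fixes h F :: "real \<Rightarrow> real"
  assumes "\<And>s. s > c \<Longrightarrow> ((\<lambda>t. exp (- s * t) * h t) has_integral F s) {0..}"
    and "d > 0" "s > c"
  shows "((\<lambda>t. (exp (- d * t) - 1) ^ k * (exp (- s * t) * h t)) has_integral (forward_difference d ^^ k) F s) {0..}"
  using assms(3)
proof (induction k arbitrary: s)
  case (Suc k)
  have "((\<lambda>t. (exp (- d * t) - 1) ^ k * (exp (- (s + d) * t) * h t) - (exp (- d * t) - 1) ^ k * (exp (- s * t) * h t))
      has_integral (forward_difference d ^^ Suc k) F s) {0..}"
    using Suc.prems assms(2) has_integral_diff[OF Suc.IH[of "s + d"] Suc.IH[of s]]
    by (simp add: forward_difference_def[of d "(forward_difference d ^^ k) F"])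
  then show ?case
    by (rule has_integral_eq[rotated]) (simp add: algebra_simps exp_add exp_diff exp_minus divide_inverse)
qed (use assms(1) in simp)

text \<open>Differences replace differentiation under the integral sign. The \<open>k\<close>-th
  difference of the transform, multiplied by \<open>(- 1) ^ k\<close>, is nonnegative. It equals
  \<open>d ^ k * D k \<xi>\<close> with \<open>\<xi>\<close> near \<open>x\<close>, and continuity
  of \<open>D k\<close> rules out the wrong sign at \<open>x\<close>.\<close>

lemma laplace_transform_alternating_derivatives:
  fixes h :: "real \<Rightarrow> real" and D :: "nat \<Rightarrow> real \<Rightarrow> real"
  assumes lap: "\<And>s. s > c \<Longrightarrow> ((\<lambda>t. exp (- s * t) * h t) has_integral D 0 s) {0..}"
    and h: "\<And>t. t \<ge> 0 \<Longrightarrow> h t \<ge> 0"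
    and D: "\<And>k y. y > c \<Longrightarrow> (D k has_real_derivative D (Suc k) y) (at y)"
    and "x > c"
  shows "(- 1) ^ k * D k x \<ge> 0"
proof (rule ccontr)
  assume not_ge: "\<not> (- 1) ^ k * D k x \<ge> 0"
  moreover have "isCont (\<lambda>y. (- 1) ^ k * D k y) x"
    using D[OF \<open>x > c\<close>, of k] DERIV_isCont by (intro continuous_intros) auto
  ultimately have "\<forall>\<^sub>F y in at x. (- 1) ^ k * D k y < 0"
    by (intro order_tendstoD(2)[of _ "(- 1) ^ k * D k x"]) (auto simp: isCont_def)
  then obtain e where e: "e > 0" "\<And>y. y \<noteq> x \<Longrightarrow> dist y x < e \<Longrightarrow> (- 1) ^ k * D k y < 0"
    by (auto simp: eventually_at)
  \<comment> \<open>This keeps \<open>k * d\<close> below \<open>e\<close>, so that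
    \<open>\<xi>\<close> falls where the sign is assumed wrong; the added 1 covers
    \<open>k = 0\<close>.\<close>
  define d where "d = e / (2 * (real k + 1))"
  have "d > 0" using e(1) by (simp add: d_def)
  have kd: "k * d < e" using e(1) by (simp add: d_def field_simps add_nonneg_pos)
  obtain \<xi> where \<xi>: "\<xi> \<ge> x" "\<xi> \<le> x + k * d" "(forward_difference d ^^ k) (D 0) x = d ^ k * D k \<xi>"
    using forward_difference_funpow_mean_value[OF \<open>d > 0\<close> \<open>x > c\<close>, of D k] D by blast
  have neg: "(- 1) ^ k * D k \<xi> < 0"
    using e(2)[of \<xi>] \<xi>(1,2) kd not_ge by (cases "\<xi> = x") (auto simp: dist_real_def)
  have "((\<lambda>t. (- 1) ^ k * ((exp (- d * t) - 1) ^ k * (exp (- x * t) * h t)))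
      has_integral (- 1) ^ k * (forward_difference d ^^ k) (D 0) x) {0..}"
    by (rule has_integral_mult_right[OF forward_difference_laplace[of c h "D 0", OF lap \<open>d > 0\<close> \<open>x > c\<close>]])
  moreover have "(- 1) ^ k * ((exp (- d * t) - 1) ^ k * (exp (- x * t) * h t)) \<ge> 0" if "t \<in> {0..}" for t
  proof -
    have "(- 1) ^ k * (exp (- d * t) - 1) ^ k = (1 - exp (- d * t)) ^ k"
      by (simp flip: power_mult_distrib)
    moreover have "\<dots> \<ge> 0" using \<open>d > 0\<close> that by simp
    ultimately show ?thesis
      using h[of t] that by (simp only: mult.assoc[symmetric]) simp
  qed
  ultimately have "(- 1) ^ k * (forward_difference d ^^ k) (D 0) x \<ge> 0"
    by (rule has_integral_nonneg)
  then have "d ^ k * ((- 1) ^ k * D k \<xi>) \<ge> 0"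
    by (simp add: \<xi>(3) mult_ac)
  with mult_pos_neg[OF zero_less_power[OF \<open>d > 0\<close>] neg, of k] show False
    by linarith
qed

text \<open>The \<open>k\<close>-th derivative is expanded around a real point \<open>y\<close> to
  the right of both \<open>c\<close> and \<open>x\<close>, in a disc reaching down to
  \<open>a\<close>. The sign of \<open>(x - y) ^ n\<close> cancels that of the \<open>n\<close>
  further derivatives, so after multiplication by \<open>(- 1) ^ k\<close> all Taylor terms are
  nonnegative.\<close>

lemma completely_monotone_beyond_extend:
  assumes cm: "completely_monotone_beyond c f" and hol: "f holomorphic_on {s. Re s > a}"
  shows "completely_monotone_beyond a f"
  unfolding completely_monotone_beyond_def
proof (intro conjI allI impI hol)
  fix k and x :: real assume x: "a < x"
  define y where "y = max x c + 1"
  have y: "y > x" "y > c" by (auto simp: y_def)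
  let ?g = "(deriv ^^ k) f"
  have sub: "ball (of_real y) (y - a) \<subseteq> {s. Re s > a}"
  proof safe
    fix s assume "s \<in> ball (complex_of_real y) (y - a)"
    then show "Re s > a"
      using abs_Re_le_cmod[of "of_real y - s"] by (auto simp: dist_norm)
  qed
  have "?g holomorphic_on ball (of_real y) (y - a)"
    using sub by (intro holomorphic_on_subset[OF holomorphic_higher_deriv[OF hol open_halfspace_Re_gt]])
  moreover have "complex_of_real x \<in> ball (of_real y) (y - a)"
    using x y by (simp add: dist_norm flip: of_real_diff)
  ultimately have "(\<lambda>n. (deriv ^^ n) ?g (of_real y) / fact n * (of_real x - of_real y) ^ n) sums ?g (of_real x)"
    by (rule holomorphic_power_series)
  then have "(\<lambda>n. (- 1) ^ k * ((deriv ^^ n) ?g (of_real y) / fact n * (of_real x - of_real y) ^ n))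
      sums ((- 1) ^ k * ?g (of_real x))"
    by (rule sums_mult)
  moreover have "(- 1) ^ k * ((deriv ^^ n) ?g (of_real y) / fact n * (of_real x - of_real y) ^ n) \<in> \<real>\<^sub>\<ge>\<^sub>0" for n
  proof -
    have "(complex_of_real x - of_real y) ^ n = (- 1) ^ n * of_real ((y - x) ^ n)"
      by (simp flip: power_mult_distrib)
    then have "(- 1) ^ k * ((deriv ^^ n) ?g (of_real y) / fact n * (of_real x - of_real y) ^ n)
        = ((- 1) ^ (n + k) * (deriv ^^ (n + k)) f (of_real y)) * of_real ((y - x) ^ n / fact n)"
      by (simp add: power_add funpow_add mult_ac)
    also have "\<dots> \<in> \<real>\<^sub>\<ge>\<^sub>0"
      using y by (intro nonneg_Reals_mult_I completely_monotone_beyondD(2)[OF cm])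
        (simp_all only: nonneg_Reals_of_real_iff, simp_all)
    finally show ?thesis .
  qed
  ultimately show "(- 1) ^ k * ?g (of_real x) \<in> \<real>\<^sub>\<ge>\<^sub>0"
    unfolding sums_def
    by (rule closed_sequentially[OF closed_nonneg_Reals_complex sum_nonneg_Reals, rotated -1])
qed

text \<open>The sign argument takes place where the integral is known to converge. From there
  complete monotonicity extends through the region of holomorphy down to \<open>a\<close>.\<close>

lemma completely_monotone_beyond_laplace:
  fixes h :: "real \<Rightarrow> real" and F :: "complex \<Rightarrow> complex"
  assumes lap: "has_laplace_transform h F" and h: "\<And>t. t \<ge> 0 \<Longrightarrow> h t \<ge> 0"
    and hol: "F holomorphic_on {s. Re s > a}"
  shows "completely_monotone_beyond a F"
proof -
  obtain c0 where c0: "\<And>s. Re s > c0 \<Longrightarrow>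
      ((\<lambda>t. exp (- s * of_real t) * of_real (h t)) has_integral F s) {0..}"
    using lap unfolding has_laplace_transform_def by blast
  define c where "c = max c0 a"
  have hol_c: "F holomorphic_on {s. Re s > c}"
    using hol by (rule holomorphic_on_subset) (auto simp: c_def)
  define D where "D k x = (deriv ^^ k) F (complex_of_real x)" for k x
  have D: "(D k has_vector_derivative D (Suc k) x) (at x)" if "x > c" for k x
    unfolding D_def[abs_def]
    by (intro has_vector_derivative_real_field has_field_derivative_higher_deriv[OF hol_c])
       (use that in \<open>auto simp: open_halfspace_Re_gt\<close>)
  have int: "((\<lambda>t. complex_of_real (exp (- x * t) * h t)) has_integral D 0 x) {0..}" if "x > c" for x
    using c0[of "of_real x"] that by (simp add: D_def c_def exp_of_real[symmetric])
  \<comment> \<open>For \<open>k = 0\<close> the integrand is real; afterwards a function vanishing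
    on an open half-line is differentiated.\<close>
  have Im: "Im (D k x) = 0" if "x > c" for k x
    using that
  proof (induction k arbitrary: x)
    case 0
    have "((\<lambda>t. Im (complex_of_real (exp (- x * t) * h t))) has_integral Im (D 0 x)) {0..}"
      using has_integral_linear[OF int[OF 0] bounded_linear_Im] by (simp add: o_def)
    then show ?case by (simp add: has_integral_0_eq)
  next
    case (Suc k)
    have "((\<lambda>x. Im (D k x)) has_real_derivative Im (D (Suc k) x)) (at x)"
      using bounded_linear.has_vector_derivative[OF bounded_linear_Im D[OF Suc.prems]]
      by (simp add: has_real_derivative_iff_has_vector_derivative)
    moreover have "((\<lambda>x. Im (D k x)) has_real_derivative 0) (at x)"
      using Suc by (intro has_field_derivative_transform_within_open[OF DERIV_const, where S = "{c<..}"]) auto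
    ultimately show ?case by (rule DERIV_unique)
  qed
  have Re: "(- 1) ^ k * Re (D k x) \<ge> 0" if "x > c" for k x
  proof (rule laplace_transform_alternating_derivatives[where D = "\<lambda>k x. Re (D k x)", OF _ h _ that])
    show "((\<lambda>t. exp (- s * t) * h t) has_integral Re (D 0 s)) {0..}" if "s > c" for s
      using has_integral_linear[OF int[OF that] bounded_linear_Re] by (simp add: o_def)
    show "((\<lambda>x. Re (D k x)) has_real_derivative Re (D (Suc k) y)) (at y)" if "y > c" for k y
      using bounded_linear.has_vector_derivative[OF bounded_linear_Re D[OF that]]
      by (simp add: has_real_derivative_iff_has_vector_derivative)
  qed
  have "completely_monotone_beyond c F"
    unfolding completely_monotone_beyond_def
  proof (intro conjI allI impI hol_c)
    fix k and x :: real assume x: "c < x"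
    have "(- 1) ^ k * (deriv ^^ k) F (of_real x) = of_real ((- 1) ^ k * Re (D k x))"
      using Im[OF x, of k] by (simp add: D_def complex_eq_iff)
    then show "(- 1) ^ k * (deriv ^^ k) F (of_real x) \<in> \<real>\<^sub>\<ge>\<^sub>0"
      using Re[OF x, of k] by (simp only: nonneg_Reals_of_real_iff)
  qed
  then show ?thesis
    using hol by (rule completely_monotone_beyond_extend)
qed

section \<open>Coefficients of the shifted numerator\<close>

lemma B_shift_Nil: "B_shift K a [] = [:of_real K:]"
  by (simp add: B_shift_def)

lemma B_shift_Cons: "B_shift K a (w # z) = [:- w - of_real a, 1:] * B_shift K a z"
  by (simp add: B_shift_def)

lemma coeff_B_shift_Cons_0:
  "coeff (B_shift K a (w # z)) 0 = - (w + of_real a) * coeff (B_shift K a z) 0"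
  by (simp add: B_shift_Cons algebra_simps)

lemma coeff_B_shift_Cons_Suc:
  "coeff (B_shift K a (w # z)) (Suc j) = coeff (B_shift K a z) j - (w + of_real a) * coeff (B_shift K a z) (Suc j)"
  by (simp add: B_shift_Cons algebra_simps)

lemma coeff_B_shift_eq_0: "length z < j \<Longrightarrow> coeff (B_shift K a z) j = 0"
proof (induction z arbitrary: j)
  case Nil
  then show ?case by (cases j) (simp_all add: B_shift_Nil)
next
  case (Cons w z)
  then show ?case by (cases j) (simp_all add: coeff_B_shift_Cons_Suc)
qed

lemma coeff_B_shift_length: "coeff (B_shift K a z) (length z) = of_real K"
  by (induction z) (simp_all add: B_shift_Nil coeff_B_shift_Cons_Suc coeff_B_shift_eq_0)

lemma poly_B_shift: "poly (B_shift K a z) s = of_real K * (\<Prod>w\<leftarrow>z. s - of_real a - w)"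
  by (induction z) (simp_all add: B_shift_Nil B_shift_Cons algebra_simps)

lemma poly_B_shift_sum:
  assumes "length z < n"
  shows "poly (B_shift K a z) s = (\<Sum>j<n. coeff (B_shift K a z) j * s ^ j)"
proof -
  have "degree (B_shift K a z) < n"
    using assms by (intro le_less_trans[OF degree_le[of "length z"]]) (auto simp: coeff_B_shift_eq_0)
  then show ?thesis
    unfolding poly_altdef by (intro sum.mono_neutral_left) (auto simp: coeff_eq_0)
qed

text \<open>\<open>B_shift K a z\<close> is the numerator translated by \<open>a\<close>, so its
  derivative in \<open>a\<close> is minus its derivative in the polynomial variable, here read off
  coefficient by coefficient.\<close>

lemma coeff_B_shift_has_vector_derivative:
  "((\<lambda>a. coeff (B_shift K a z) j) has_vector_derivative
     - of_nat (Suc j) * coeff (B_shift K a z) (Suc j)) (at a)"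
proof (induction z arbitrary: j)
  case Nil
  then show ?case by (cases j) (simp_all add: B_shift_Nil)
next
  case (Cons w z)
  have lin: "((\<lambda>a. w + complex_of_real a) has_vector_derivative 1) (at a)"
    by (auto intro!: derivative_eq_intros has_vector_derivative_real_field)
  show ?case
  proof (cases j)
    case 0
    show ?thesis
      unfolding 0 coeff_B_shift_Cons_0 coeff_B_shift_Cons_Suc
      by (rule has_vector_derivative_eq_rhs[OF has_vector_derivative_mult[OF has_vector_derivative_minus[OF lin] Cons.IH]])
         (simp add: algebra_simps)
  next
    case (Suc i)
    show ?thesis
      unfolding Suc coeff_B_shift_Cons_Suc
      by (rule has_vector_derivative_eq_rhs[OF has_vector_derivative_diff[OF Cons.IH
            has_vector_derivative_mult[OF lin Cons.IH]]])
         (simp add: algebra_simps)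
  qed
qed

text \<open>Conjugating the coefficients amounts to conjugating the zeros, which merely permutes the
  factors.\<close>

lemma B_shift_conj_real:
  assumes "conj_closed z"
  shows "coeff (B_shift K a z) j \<in> \<real>"
proof -
  have "cnj (coeff (B_shift K a z) j) = coeff (B_shift K a (map cnj z)) j"
  proof (induction z arbitrary: j)
    case Nil
    then show ?case by (cases j) (simp_all add: B_shift_Nil)
  next
    case (Cons w z)
    then show ?case
      by (cases j) (simp_all add: coeff_B_shift_Cons_0 coeff_B_shift_Cons_Suc)
  qed
  also have "B_shift K a (map cnj z) = B_shift K a z"
  proof -
    have "(\<Prod>w\<leftarrow>xs. [:- w - of_real a, 1:]) = (\<Prod>w\<in>#mset xs. [:- w - of_real a, 1:])" for xs :: "complex list"
      by (simp flip: prod_mset_prod_list)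
    then show ?thesis
      using assms unfolding B_shift_def conj_closed_def by metis
  qed
  finally show ?thesis
    by (simp add: Reals_cnj_iff)
qed

text \<open>The real part is taken to obtain a real-valued function; for conjugation-closed
  \<open>z\<close> it is the coefficient itself.\<close>

definition shifted_coeff :: "real \<Rightarrow> complex list \<Rightarrow> real \<Rightarrow> nat \<Rightarrow> real" where
  "shifted_coeff K z a j = Re (coeff (B_shift K a z) j)"

lemma of_real_shifted_coeff:
  "conj_closed z \<Longrightarrow> of_real (shifted_coeff K z a j) = coeff (B_shift K a z) j"
  unfolding shifted_coeff_def by (intro of_real_Re B_shift_conj_real)

lemma shifted_coeff_length: "shifted_coeff K z a (length z) = K"
  by (simp add: shifted_coeff_def coeff_B_shift_length)

lemma shifted_coeff_eq_0: "length z < j \<Longrightarrow> shifted_coeff K z a j = 0"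
  by (simp add: shifted_coeff_def coeff_B_shift_eq_0)

lemma shifted_coeff_has_real_derivative:
  "((\<lambda>a. shifted_coeff K z a j) has_real_derivative - real (Suc j) * shifted_coeff K z a (Suc j)) (at a)"
  using bounded_linear.has_vector_derivative[OF bounded_linear_Re coeff_B_shift_has_vector_derivative[of K z j a]]
  by (simp add: has_real_derivative_iff_has_vector_derivative shifted_coeff_def[abs_def])

text \<open>The polynomial \<open>poly_tilde\<close> over the reals, indexed by the power
  \<open>j = n - i\<close>, so that \<open>fact (i - 1)\<close> becomes
  \<open>fact (n - 1 - j)\<close>. The shift \<open>a\<close> is an argument because it is
  differentiated and perturbed later.\<close>

definition shifted_tilde :: "real \<Rightarrow> complex list \<Rightarrow> nat \<Rightarrow> real \<Rightarrow> real \<Rightarrow> real" where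
  "shifted_tilde K z n a y = (\<Sum>j<n. shifted_coeff K z a j * y ^ j / fact (n - 1 - j))"

lemma poly_tilde_B_shift:
  assumes "conj_closed z"
  shows "poly (poly_tilde n (B_shift K a z)) (of_real y) = of_real (shifted_tilde K z n a y)"
proof -
  have "poly (poly_tilde n (B_shift K a z)) (of_real y)
      = (\<Sum>i=1..n. coeff (B_shift K a z) (n - i) / fact (i - 1) * of_real y ^ (n - i))"
    by (simp add: poly_tilde_def poly_sum poly_monom)
  also have "\<dots> = (\<Sum>j<n. coeff (B_shift K a z) j / fact (n - 1 - j) * of_real y ^ j)"
    by (rule sum.reindex_bij_witness[of _ "\<lambda>j. n - j" "\<lambda>i. n - i"]) (auto simp: diff_right_commute)
  finally show ?thesis
    by (simp add: shifted_tilde_def flip: of_real_shifted_coeff[OF assms])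
qed

section \<open>Asymptotics of rising factorials and inversion of partial fractions\<close>

lemma pochhammer_of_nat_Suc: "pochhammer (of_nat (Suc r)) k = (fact (r + k) / fact r :: 'a::field_char_0)"
proof (induction k)
  case (Suc k)
  show ?case
    unfolding pochhammer_Suc Suc.IH by (simp add: field_simps)
qed simp

text \<open>\<open>pochhammer (Suc r) k / fact k\<close> is the binomial coefficient
  \<open>(r + k) choose r\<close>, which grows like \<open>k ^ r / fact r\<close>.\<close>

lemma pochhammer_asymptotics:
  "(\<lambda>k. pochhammer (real (Suc r)) k / (fact k * real k ^ r)) \<longlonglongrightarrow> 1 / fact r"
proof -
  have "(\<lambda>k. fact (r + k) / (fact k * real k ^ r)) \<longlonglongrightarrow> (1::real)"
  proof (induction r)
    case 0
    then show ?case by simp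
  next
    case (Suc r)
    have "(\<lambda>k. (real r + 1 + real k) / real k) \<longlonglongrightarrow> 1"
      by real_asymp
    from tendsto_mult[OF this Suc] show ?case
      by (simp add: mult_ac add_ac)
  qed
  from tendsto_divide[OF this tendsto_const[of "fact r"]] show ?thesis
    unfolding pochhammer_of_nat_Suc by (simp add: mult_ac)
qed

text \<open>This is the Post--Widder inversion formula for \<open>\<Sum>j<n. b j / s ^ (n - j)\<close>.\<close>

lemma tilde_nonneg_of_pochhammer_sums:
  fixes b :: "nat \<Rightarrow> real"
  assumes nonneg: "\<And>k x. x > 0 \<Longrightarrow> (\<Sum>j<n. b j * pochhammer (real (n - j)) k * x ^ j) \<ge> 0" and "y > 0"
  shows "(\<Sum>j<n. b j * y ^ j / fact (n - 1 - j)) \<ge> 0"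
proof (rule LIMSEQ_le_const)
  \<comment> \<open>\<open>?S\<close> is the hypothesis at \<open>x = k * y\<close>, divided by
    \<open>fact k * k ^ (n - 1)\<close>. \<open>?T\<close> distributes the powers of
    \<open>k\<close> over the terms, each of which then has a limit.\<close>
  let ?S = "\<lambda>k. (\<Sum>j<n. b j * pochhammer (real (n - j)) k * (real k * y) ^ j) / (fact k * real k ^ (n - 1))"
  let ?T = "\<lambda>k. \<Sum>j<n. b j * y ^ j * (pochhammer (real (Suc (n - 1 - j))) k / (fact k * real k ^ (n - 1 - j)))"
  have "?T \<longlonglongrightarrow> (\<Sum>j<n. b j * y ^ j * (1 / fact (n - 1 - j)))"
    by (intro tendsto_intros pochhammer_asymptotics)
  moreover have "\<forall>\<^sub>F k in sequentially. ?T k = ?S k"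
  proof (intro eventually_sequentiallyI[of 1])
    fix k :: nat assume "k \<ge> 1"
    show "?T k = ?S k"
      unfolding sum_divide_distrib
    proof (rule sum.cong)
      fix j assume "j \<in> {..<n}"
      then have "Suc (n - 1 - j) = n - j" and "real k ^ (n - 1) = real k ^ j * real k ^ (n - 1 - j)"
        by (auto simp flip: power_add)
      then show "b j * y ^ j * (pochhammer (real (Suc (n - 1 - j))) k / (fact k * real k ^ (n - 1 - j)))
          = b j * pochhammer (real (n - j)) k * (real k * y) ^ j / (fact k * real k ^ (n - 1))"
        using \<open>k \<ge> 1\<close> by (simp add: power_mult_distrib field_simps del: of_nat_diff)
    qed simp
  qed
  ultimately show "?S \<longlonglongrightarrow> (\<Sum>j<n. b j * y ^ j / fact (n - 1 - j))"
    by (auto dest: Lim_transform_eventually)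
  show "\<exists>N. \<forall>k\<ge>N. 0 \<le> ?S k"
    using \<open>y > 0\<close> by (intro exI[of _ 1] allI impI divide_nonneg_nonneg nonneg) auto
qed

lemma higher_deriv_sum:
  fixes z :: complex
  assumes "\<And>i. i \<in> I \<Longrightarrow> f i holomorphic_on S" "open S" "z \<in> S"
  shows "(deriv ^^ k) (\<lambda>s. \<Sum>i\<in>I. f i s) z = (\<Sum>i\<in>I. (deriv ^^ k) (f i) z)"
  using assms(1)
proof (induction I rule: infinite_finite_induct)
  case (insert i I)
  have "(deriv ^^ k) (\<lambda>s. f i s + (\<Sum>i\<in>I. f i s)) z = (deriv ^^ k) (f i) z + (deriv ^^ k) (\<lambda>s. \<Sum>i\<in>I. f i s) z"
    using insert.prems by (intro higher_deriv_add[OF _ _ assms(2,3)] holomorphic_intros) auto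
  then show ?case
    using insert by simp
qed auto

text \<open>The \<open>k\<close>-th derivative at \<open>a + x\<close> is explicit; removing its
  sign and multiplying by \<open>x ^ (n + k)\<close> leaves a polynomial in
  \<open>x\<close>.\<close>

lemma completely_monotone_beyond_partial_fraction:
  fixes b :: "nat \<Rightarrow> real"
  assumes cm: "completely_monotone_beyond a (\<lambda>s. \<Sum>j<n. of_real (b j) * (1 / (s - of_real a) ^ (n - j)))"
    and "x > 0"
  shows "(\<Sum>j<n. b j * pochhammer (real (n - j)) k * x ^ j) \<ge> 0"
proof -
  let ?S = "{s. Re s > a}"
  have z: "complex_of_real (a + x) \<in> ?S" "open ?S"
    using \<open>x > 0\<close> by (auto simp: open_halfspace_Re_gt)
  have hol: "(\<lambda>s. 1 / (s - complex_of_real a) ^ i) holomorphic_on ?S" for i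
    by (auto intro!: holomorphic_intros)
  have "(deriv ^^ k) (\<lambda>s. \<Sum>j<n. of_real (b j) * (1 / (s - complex_of_real a) ^ (n - j))) (of_real (a + x))
      = (\<Sum>j<n. of_real (b j) * ((- 1) ^ k * pochhammer (of_nat (n - j)) k / (of_real (a + x) - of_real a) ^ (n - j + k)))"
    using \<open>x > 0\<close>
    by (subst higher_deriv_sum[OF _ z(2,1)] higher_deriv_cmult[OF hol z] higher_deriv_inverse_power;
        (intro holomorphic_intros hol)?)+ auto
  also have "\<dots> = of_real ((- 1) ^ k * (\<Sum>j<n. b j * pochhammer (real (n - j)) k / x ^ (n - j + k)))"
    by (simp add: sum_distrib_left mult_ac flip: pochhammer_of_real)
  finally have "(- 1) ^ k * of_real ((- 1) ^ k * (\<Sum>j<n. b j * pochhammer (real (n - j)) k / x ^ (n - j + k))) \<in> (\<real>\<^sub>\<ge>\<^sub>0 :: complex set)"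
    using completely_monotone_beyondD(2)[OF cm, of "a + x" k] \<open>x > 0\<close> by simp
  then have "complex_of_real ((- 1) ^ k * (- 1) ^ k * (\<Sum>j<n. b j * pochhammer (real (n - j)) k / x ^ (n - j + k))) \<in> \<real>\<^sub>\<ge>\<^sub>0"
    by (simp add: mult.assoc)
  then have "(- 1) ^ k * (- 1) ^ k * (\<Sum>j<n. b j * pochhammer (real (n - j)) k / x ^ (n - j + k)) \<ge> 0"
    by (simp only: nonneg_Reals_of_real_iff)
  then have "(\<Sum>j<n. b j * pochhammer (real (n - j)) k / x ^ (n - j + k)) \<ge> 0"
    by (simp flip: power_mult_distrib)
  then have "x ^ (n + k) * (\<Sum>j<n. b j * pochhammer (real (n - j)) k / x ^ (n - j + k)) \<ge> 0"
    using \<open>x > 0\<close> by simp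
  also have "x ^ (n + k) * (\<Sum>j<n. b j * pochhammer (real (n - j)) k / x ^ (n - j + k))
      = (\<Sum>j<n. b j * pochhammer (real (n - j)) k * x ^ j)"
    unfolding sum_distrib_left
  proof (rule sum.cong)
    fix j assume "j \<in> {..<n}"
    then have "x ^ (n + k) = x ^ j * x ^ (n - j + k)"
      by (simp flip: power_add)
    then show "x ^ (n + k) * (b j * pochhammer (real (n - j)) k / x ^ (n - j + k))
        = b j * pochhammer (real (n - j)) k * x ^ j"
      using \<open>x > 0\<close> by simp
  qed simp
  finally show ?thesis .
qed

section \<open>Necessity\<close>

lemma holomorphic_on_prod_list_diff [holomorphic_intros]: "(\<lambda>s. \<Prod>w\<leftarrow>ws. s - w) holomorphic_on S"
  by (induction ws) (auto intro!: holomorphic_intros)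

lemma completely_monotone_beyond_tf_eval:
  assumes "externally_positive H" "\<And>w. w \<in> set (poles H) \<Longrightarrow> Re w \<le> a"
  shows "completely_monotone_beyond a (tf_eval H)"
proof -
  obtain h where h: "has_laplace_transform h (tf_eval H)" "\<And>t. t \<ge> 0 \<Longrightarrow> h t \<ge> 0"
    using assms(1) unfolding externally_positive_def is_impulse_response_def by blast
  have "(\<Prod>w\<leftarrow>poles H. s - w) \<noteq> 0" if "Re s > a" for s
    using assms(2) that by (force simp: prod_list_zero_iff)
  then have "tf_eval H holomorphic_on {s. Re s > a}"
    unfolding tf_eval_def[abs_def] by (intro holomorphic_intros) auto
  with h show ?thesis
    by (rule completely_monotone_beyond_laplace)
qed

text \<open>The coefficients of \<open>B_shift K a z\<close> are the Taylor coefficients of the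
  numerator at \<open>- a\<close>.\<close>

lemma tf_eval_B_shift:
  assumes "length z < n"
  shows "of_real K * (\<Prod>w\<leftarrow>z. s - w) = (\<Sum>j<n. coeff (B_shift K a z) j * (s + of_real a) ^ j)"
  using poly_B_shift[of K a z "s + of_real a"] poly_B_shift_sum[OF assms, of K a "s + of_real a"] by simp

lemma partial_fraction_sum:
  fixes u :: complex
  assumes "u \<noteq> 0"
  shows "(\<Sum>j<n. b j * u ^ j) / u ^ n = (\<Sum>j<n. b j * (1 / u ^ (n - j)))"
  unfolding sum_divide_distrib
proof (rule sum.cong)
  fix j assume "j \<in> {..<n}"
  then have "u ^ n = u ^ j * u ^ (n - j)"
    by (simp flip: power_add)
  then show "b j * u ^ j / u ^ n = b j * (1 / u ^ (n - j))"
    using assms by simp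
qed simp

text \<open>Multiplying the transfer function by \<open>\<Prod>w. (s - w) / (s + a)\<close> moves all poles to \<open>-a\<close> and
  preserves complete monotonicity.\<close>

lemma shifted_tilde_nonneg:
  assumes pos: "externally_positive (Transfer_Function K z p)"
    and "conj_closed z" "conj_closed p" "length z < length p"
    and le: "\<And>w. w \<in> set p \<Longrightarrow> Re w \<le> - a" and "y > 0"
  shows "shifted_tilde K z (length p) a y \<ge> 0"
proof -
  let ?H = "Transfer_Function K z p" and ?n = "length p" and ?b = "shifted_coeff K z a"
  have "completely_monotone_beyond (- a) (\<lambda>s. tf_eval ?H s * (\<Prod>w\<in>#mset p. (s - w) / (s - of_real (- a))))"
    using assms by (intro completely_monotone_beyond_mult completely_monotone_beyond_tf_eval
        completely_monotone_beyond_prod_conj) (auto simp: conj_closed_def)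
  then have "completely_monotone_beyond (- a) (\<lambda>s. \<Sum>j<?n. of_real (?b j) * (1 / (s - of_real (- a)) ^ (?n - j)))"
  proof (rule completely_monotone_beyond_cong)
    fix s assume s: "Re s > - a"
    then have u: "s + of_real a \<noteq> 0"
      by (auto simp: complex_eq_iff)
    have p: "(\<Prod>w\<leftarrow>p. s - w) \<noteq> 0"
      using le s by (force simp: prod_list_zero_iff)
    have "(\<Prod>w\<in>#mset p. (s - w) / (s + of_real a)) = (\<Prod>w\<leftarrow>p. s - w) / (s + of_real a) ^ ?n"
      by (induction p) auto
    then have "tf_eval ?H s * (\<Prod>w\<in>#mset p. (s - w) / (s + of_real a))
        = (\<Sum>j<?n. of_real (?b j) * (s + of_real a) ^ j) / (s + of_real a) ^ ?n"
      using p tf_eval_B_shift[OF assms(4), of K s a]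
      by (simp add: tf_eval_def of_real_shifted_coeff assms)
    then show "tf_eval ?H s * (\<Prod>w\<in>#mset p. (s - w) / (s - of_real (- a)))
        = (\<Sum>j<?n. of_real (?b j) * (1 / (s - of_real (- a)) ^ (?n - j)))"
      by (simp add: partial_fraction_sum[OF u])
  qed
  from completely_monotone_beyond_partial_fraction[OF this] show ?thesis
    unfolding shifted_tilde_def using \<open>y > 0\<close> by (rule tilde_nonneg_of_pochhammer_sums)
qed

section \<open>Excluding roots of the tilde polynomial\<close>

lemma completely_monotone_beyond_zero:
  assumes cm: "completely_monotone_beyond a f" and "x > a" "f (of_real x) = 0" "x \<le> y"
  shows "f (of_real y) = 0"
proof -
  have deriv: "((\<lambda>x. Re (f (of_real x))) has_real_derivative Re (deriv f (of_real x))) (at x)" if "x > a" for x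
  proof -
    have "(f has_field_derivative deriv f (of_real x)) (at (of_real x))"
      using that by (intro holomorphic_derivI[OF completely_monotone_beyondD(1)[OF cm] open_halfspace_Re_gt]) simp
    from bounded_linear.has_vector_derivative[OF bounded_linear_Re has_vector_derivative_real_field[OF this]]
    show ?thesis
      by (simp add: has_real_derivative_iff_has_vector_derivative)
  qed
  \<comment> \<open>Order 1 of complete monotonicity makes the function nonincreasing and order 0
    keeps it nonnegative, so a zero persists to the right.\<close>
  have "Re (f (of_real y)) \<le> Re (f (of_real x))"
  proof (rule DERIV_nonpos_imp_nonincreasing[OF \<open>x \<le> y\<close>])
    fix t assume "x \<le> t" "t \<le> y"
    then show "\<exists>d. ((\<lambda>x. Re (f (of_real x))) has_real_derivative d) (at t) \<and> d \<le> 0"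
      using deriv[of t] completely_monotone_beyondD(2)[OF cm, of t 1] \<open>x > a\<close>
      by (intro exI[of _ "Re (deriv f (of_real t))"]) (auto simp: complex_nonneg_Reals_iff)
  qed
  moreover have "f (of_real y) \<in> \<real>\<^sub>\<ge>\<^sub>0"
    using completely_monotone_beyondD(2)[OF cm, of y 0] assms by simp
  ultimately show ?thesis
    using assms(3) by (simp add: complex_nonneg_Reals_iff complex_eq_iff)
qed

text \<open>At argument 0 only the constant coefficient survives, a multiple of the value of the
  numerator at \<open>- a\<close>. A zero of the transfer function there would persist to the right
  of \<open>- a\<close>, but the finite list \<open>z\<close> cannot contain a half-line.\<close>

lemma shifted_tilde_0_nonzero:
  assumes "externally_positive (Transfer_Function K z p)" "K \<noteq> 0" "p \<noteq> []"
    and "conj_closed z" and lt: "\<And>w. w \<in> set p \<Longrightarrow> Re w < - a"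
  shows "shifted_tilde K z (length p) a 0 \<noteq> 0"
proof
  let ?H = "Transfer_Function K z p"
  assume zero: "shifted_tilde K z (length p) a 0 = 0"
  have "shifted_tilde K z (length p) a 0
      = (\<Sum>j<length p. if j = 0 then shifted_coeff K z a 0 / fact (length p - 1) else 0)"
    unfolding shifted_tilde_def by (intro sum.cong) auto
  with zero \<open>p \<noteq> []\<close> have "shifted_coeff K z a 0 = 0"
    by simp
  then have "poly (B_shift K a z) 0 = 0"
    using of_real_shifted_coeff[OF \<open>conj_closed z\<close>, of K a 0] by (simp add: poly_0_coeff_0)
  then have zero: "tf_eval ?H (of_real (- a)) = 0"
    by (simp add: poly_B_shift tf_eval_def)
  \<comment> \<open>Strictness of \<open>c < - a\<close> places \<open>- a\<close> inside the open
    half-line of complete monotonicity.\<close>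
  define c where "c = Max (Re ` set p)"
  have c: "Re w \<le> c" if "w \<in> set p" for w
    using that by (simp add: c_def)
  have "c < - a"
    using \<open>p \<noteq> []\<close> lt by (simp add: c_def)
  have "completely_monotone_beyond c (tf_eval ?H)"
    using assms(1) c by (intro completely_monotone_beyond_tf_eval) auto
  from completely_monotone_beyond_zero[OF this \<open>c < - a\<close> zero]
  have "tf_eval ?H (of_real x) = 0" if "- a \<le> x" for x
    using that by blast
  moreover have "(\<Prod>w\<leftarrow>p. of_real x - w) \<noteq> 0" if "- a \<le> x" for x
    using lt that by (force simp: prod_list_zero_iff)
  ultimately have "complex_of_real x \<in> set z" if "- a \<le> x" for x
    using that \<open>K \<noteq> 0\<close> by (force simp: tf_eval_def prod_list_zero_iff)
  then have "complex_of_real ` {- a..} \<subseteq> set z"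
    by auto
  then have "finite (complex_of_real ` {- a..})"
    using finite_subset by blast
  then have "finite {- a..}"
    by (rule finite_imageD) (simp add: inj_on_def)
  then show False
    using infinite_Ici by blast
qed

text \<open>Nonnegativity for shifts on both sides of \<open>a\<close> makes a zero a critical point
  in the shift. Value and derivative then vanish together, which forces the nondecreasing polynomial
  \<open>S\<close> to be 0 at both ends of \<open>{0..1 / y}\<close>, hence throughout.\<close>

lemma shifted_tilde_nonzero:
  assumes nonneg: "\<And>a y. a < c \<Longrightarrow> y > 0 \<Longrightarrow> shifted_tilde K z n a y \<ge> 0"
    and "a < c" "y > 0" "K \<noteq> 0" "length z < n"
  shows "shifted_tilde K z n a y \<noteq> 0"
proof
  let ?b = "shifted_coeff K z a"
  assume zero: "shifted_tilde K z n a y = 0"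
  \<comment> \<open>Index \<open>n\<close> enters through the index shift in the derivative and as
    the constant term of \<open>S\<close>.\<close>
  have bn: "?b n = 0"
    using \<open>length z < n\<close> by (rule shifted_coeff_eq_0)
  text \<open>As a function of \<open>a\<close>, the tilde polynomial at \<open>y\<close> has an interior minimum, so its derivative vanishes.\<close>
  have "((\<lambda>a. shifted_tilde K z n a y) has_real_derivative
      (\<Sum>j<n. - real (Suc j) * ?b (Suc j) * y ^ j / fact (n - 1 - j))) (at a)"
    unfolding shifted_tilde_def by (intro derivative_intros DERIV_cdivide DERIV_cmult_right shifted_coeff_has_real_derivative)
  then have "(\<Sum>j<n. - real (Suc j) * ?b (Suc j) * y ^ j / fact (n - 1 - j)) = 0"
    by (rule DERIV_local_min[of _ _ _ "c - a"]) (use nonneg zero \<open>a < c\<close> \<open>y > 0\<close> in \<open>auto simp: abs_if split: if_splits\<close>)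
  \<comment> \<open>Multiplication by \<open>- y\<close> and an index shift produce the weights
    \<open>j / fact (n - j)\<close>. The tilde polynomial has the weights
    \<open>1 / fact (n - 1 - j) = (n - j) / fact (n - j)\<close>, so together they give
    \<open>n / fact (n - j)\<close>.\<close>
  then have "- y * (\<Sum>j<n. - real (Suc j) * ?b (Suc j) * y ^ j / fact (n - 1 - j)) = 0"
    by simp
  also have "- y * (\<Sum>j<n. - real (Suc j) * ?b (Suc j) * y ^ j / fact (n - 1 - j))
      = (\<Sum>j<n. real (Suc j) * ?b (Suc j) * y ^ Suc j / fact (n - Suc j))"
    by (auto simp: sum_distrib_left mult_ac intro!: sum.cong simp del: of_nat_Suc)
  also have "\<dots> = (\<Sum>j<n. real j * ?b j * y ^ j / fact (n - j))"
    using bn sum.lessThan_Suc_shift[of "\<lambda>j. real j * ?b j * y ^ j / fact (n - j)" n] by simp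
  finally have "(\<Sum>j<n. real j * ?b j * y ^ j / fact (n - j)) + shifted_tilde K z n a y = 0"
    using zero by simp
  also have "(\<Sum>j<n. real j * ?b j * y ^ j / fact (n - j)) + shifted_tilde K z n a y
      = (\<Sum>j<n. real n * (?b j * y ^ j / fact (n - j)))"
    unfolding shifted_tilde_def sum.distrib[symmetric]
  proof (rule sum.cong)
    fix j assume "j \<in> {..<n}"
    then obtain i where i: "n = Suc (j + i)"
      using less_imp_Suc_add by auto
    have alg: "x * X / (c * f) + X / f = (x + c) * (X / (c * f))" if "c \<noteq> 0" "f \<noteq> 0" for c f x X :: real
      using that by (simp add: field_simps)
    have "fact (n - j) = real (Suc i) * fact i" "n - 1 - j = i" "real n = real j + real (Suc i)"
      by (simp_all add: i)
    then show "real j * ?b j * y ^ j / fact (n - j) + ?b j * y ^ j / fact (n - 1 - j) = real n * (?b j * y ^ j / fact (n - j))"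
      using alg[of "real (Suc i)" "fact i" "real j" "?b j * y ^ j"] by (simp only: mult.assoc) simp
  qed simp
  finally have W: "(\<Sum>j<n. ?b j * y ^ j / fact (n - j)) = 0"
    using \<open>length z < n\<close> unfolding sum_distrib_left[symmetric] by simp
  text \<open>\<open>S\<close> is the antiderivative of the inverse Laplace transform of \<open>\<Sum>j<n. ?b j / s ^ (n - j)\<close>.\<close>
  define S where "S t = (\<Sum>i\<le>n. ?b (n - i) / fact i * t ^ i)" for t
  have "S 0 = (\<Sum>i\<le>n. if i = 0 then ?b n else 0)"
    unfolding S_def by (intro sum.cong) auto
  then have S0: "S 0 = 0"
    using bn by simp
  have "S (1 / y) = (\<Sum>j\<le>n. ?b j / fact (n - j) * (1 / y) ^ (n - j))"
    unfolding S_def by (rule sum.reindex_bij_witness[of _ "\<lambda>j. n - j" "\<lambda>j. n - j"]) auto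
  also have "\<dots> = (\<Sum>j\<le>n. (?b j * y ^ j / fact (n - j)) / y ^ n)"
  proof (rule sum.cong)
    fix j assume "j \<in> {..n}"
    then have "y ^ n = y ^ j * y ^ (n - j)"
      by (simp flip: power_add)
    then show "?b j / fact (n - j) * (1 / y) ^ (n - j) = (?b j * y ^ j / fact (n - j)) / y ^ n"
      using \<open>y > 0\<close> by (simp add: power_divide)
  qed simp
  also have "\<dots> = 0"
    using W bn unfolding sum_divide_distrib[symmetric] lessThan_Suc_atMost[symmetric] by simp
  finally have S1: "S (1 / y) = 0" .
  have deriv: "(S has_real_derivative t ^ (n - 1) * shifted_tilde K z n a (1 / t)) (at t)" if "t > 0" for t
  proof -
    have "(S has_real_derivative (\<Sum>i\<le>n. ?b (n - i) / fact i * (real i * t ^ (i - 1)))) (at t)"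
      unfolding S_def[abs_def] by (auto intro!: derivative_eq_intros sum.cong)
    also have "(\<Sum>i\<le>n. ?b (n - i) / fact i * (real i * t ^ (i - 1))) = (\<Sum>i<n. ?b (n - Suc i) / fact i * t ^ i)"
      unfolding lessThan_Suc_atMost[symmetric] sum.lessThan_Suc_shift
      by (auto intro!: sum.cong simp del: of_nat_Suc)
    also have "\<dots> = (\<Sum>j<n. ?b j / fact (n - Suc j) * t ^ (n - Suc j))"
      by (rule sum.reindex_bij_witness[of _ "\<lambda>j. n - Suc j" "\<lambda>j. n - Suc j"]) auto
    also have "\<dots> = t ^ (n - 1) * shifted_tilde K z n a (1 / t)"
      unfolding shifted_tilde_def sum_distrib_left
    proof (rule sum.cong)
      fix j assume "j \<in> {..<n}"
      then have "t ^ (n - 1) = t ^ j * t ^ (n - 1 - j)"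
        by (simp flip: power_add)
      then show "?b j / fact (n - Suc j) * t ^ (n - Suc j) = t ^ (n - 1) * (?b j * (1 / t) ^ j / fact (n - 1 - j))"
        using \<open>t > 0\<close> by (simp add: power_divide)
    qed simp
    finally show ?thesis .
  qed
  have cont: "continuous_on A S" for A
    unfolding S_def by (intro continuous_intros)
  have mono: "S u \<le> S v" if "0 \<le> u" "u \<le> v" for u v
    using that(2)
  \<comment> \<open>The derivative formula contains \<open>1 / t\<close>, so it is used at interior
    points only; continuity covers the endpoint 0.\<close>
  proof (rule DERIV_nonneg_imp_increasing_open[OF _ _ cont])
    fix t assume "u < t" "t < v"
    then have "t > 0" using that by simp
    then show "\<exists>d. (S has_real_derivative d) (at t) \<and> d \<ge> 0"
      using deriv[of t] nonneg[OF \<open>a < c\<close>, of "1 / t"] by (auto intro!: exI mult_nonneg_nonneg)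
  qed
  have "S t = 0" if "t \<in> {0..1 / y}" for t
    using mono[of 0 t] mono[of t "1 / y"] that S0 S1 by auto
  then have "{0..1 / y} \<subseteq> {t. (\<Sum>i\<le>n. ?b (n - i) / fact i * t ^ i) = 0}"
    by (auto simp: S_def)
  \<comment> \<open>\<open>S\<close> is a nonzero polynomial: its coefficient at
    \<open>n - length z\<close> is \<open>K\<close> over a factorial.\<close>
  moreover have "finite {t. (\<Sum>i\<le>n. ?b (n - i) / fact i * t ^ i) = 0}"
    using \<open>K \<noteq> 0\<close> \<open>length z < n\<close>
    by (intro polyfun_finite_roots[THEN iffD2] exI[of _ "n - length z"]) (auto simp: shifted_coeff_length)
  ultimately have "finite {0..1 / y}"
    by (rule finite_subset)
  with infinite_Icc[of 0 "1 / y"] \<open>y > 0\<close> show False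
    by simp
qed

section \<open>Sufficiency\<close>

text \<open>Divided by \<open>(1 + y) ^ m\<close>, the polynomial becomes a continuous function
  without zeros on a compact interval, positive at the end that stands for infinity. A bound of this
  growth absorbs small changes of all coefficients uniformly in \<open>y\<close>.\<close>

lemma polynomial_lower_bound:
  fixes b :: "nat \<Rightarrow> real"
  assumes nz: "\<And>y. y \<ge> 0 \<Longrightarrow> (\<Sum>j\<le>m. b j * y ^ j) \<noteq> 0" and "b m > 0"
  obtains c where "c > 0" "\<And>y. y \<ge> 0 \<Longrightarrow> (\<Sum>j\<le>m. b j * y ^ j) \<ge> c * (1 + y) ^ m"
proof -
  text \<open>The substitution \<open>x = y / (1 + y)\<close> compactifies the half-line.\<close>
  define F where "F x = (\<Sum>j\<le>m. b j * x ^ j * (1 - x) ^ (m - j))" for x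
  have homog: "(\<Sum>j\<le>m. b j * y ^ j) = F (y / (1 + y)) * (1 + y) ^ m" if "y \<ge> 0" for y
    unfolding F_def sum_distrib_right
  proof (rule sum.cong)
    fix j assume "j \<in> {..m}"
    then have pow: "(1 + y) ^ m = (1 + y) ^ j * (1 + y) ^ (m - j)"
      by (simp flip: power_add)
    have "1 - y / (1 + y) = 1 / (1 + y)"
      using that by (simp add: field_simps)
    then show "b j * y ^ j = b j * (y / (1 + y)) ^ j * (1 - y / (1 + y)) ^ (m - j) * (1 + y) ^ m"
      using that unfolding pow by (simp add: power_divide)
  qed simp
  have cont: "continuous_on {0..1} F"
    unfolding F_def by (intro continuous_intros)
  have F1: "F 1 > 0"
  proof -
    have "F 1 = (\<Sum>j\<le>m. if j = m then b m else 0)"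
      unfolding F_def by (intro sum.cong) auto
    then show ?thesis using \<open>b m > 0\<close> by simp
  qed
  have F_nz: "F x \<noteq> 0" if "x \<in> {0..1}" for x
  proof (cases "x = 1")
    case False
    then have "x < 1" using that by simp
    define y where "y = x / (1 - x)"
    have "y \<ge> 0" and "y / (1 + y) = x"
      using \<open>x < 1\<close> that by (auto simp: y_def field_simps)
    then show ?thesis
      using nz[of y] homog[of y] by auto
  qed (use F1 in auto)
  obtain x where x: "x \<in> {0..1}" "\<And>u. u \<in> {0..1} \<Longrightarrow> F x \<le> F u"
    using continuous_attains_inf[OF compact_Icc _ cont] by auto
  have "F x > 0"
  proof (rule ccontr)
    assume "\<not> F x > 0"
    then have "\<exists>u\<ge>x. u \<le> 1 \<and> F u = 0"
      using F1 x(1) by (intro IVT') (auto intro: continuous_on_subset[OF cont])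
    with F_nz x(1) show False by auto
  qed
  then show thesis
  proof (rule that)
    fix y :: real assume "y \<ge> 0"
    then have "y / (1 + y) \<in> {0..1}" by auto
    with x(2) \<open>y \<ge> 0\<close> show "(\<Sum>j\<le>m. b j * y ^ j) \<ge> F x * (1 + y) ^ m"
      by (subst homog) (auto intro: mult_right_mono)
  qed
qed

text \<open>If the coefficients change by less than \<open>c\<close> in total, the value at
  \<open>y\<close> changes by less than \<open>c * (1 + y) ^ length z\<close>, which the lower bound
  at \<open>a0\<close> outweighs.\<close>

lemma eventually_shifted_tilde_pos:
  assumes "length z < n" "K > 0" and nz: "\<And>y. y \<ge> 0 \<Longrightarrow> shifted_tilde K z n a0 y \<noteq> 0"
  shows "\<forall>\<^sub>F a in at a0. \<forall>y\<ge>0. shifted_tilde K z n a y > 0"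
proof -
  let ?m = "length z"
  define b where "b a j = shifted_coeff K z a j / fact (n - 1 - j)" for a j
  \<comment> \<open>Stopping at \<open>length z\<close> makes the last coefficient a positive
    multiple of \<open>K\<close>, as the lower bound requires.\<close>
  have tilde: "shifted_tilde K z n a y = (\<Sum>j\<le>?m. b a j * y ^ j)" for a y
  proof -
    have "(\<Sum>j\<le>?m. b a j * y ^ j) = (\<Sum>j<n. b a j * y ^ j)"
      using \<open>length z < n\<close> by (intro sum.mono_neutral_left) (auto simp: b_def shifted_coeff_eq_0)
    then show ?thesis
      by (simp add: shifted_tilde_def b_def)
  qed
  have "b a0 ?m > 0"
    using \<open>K > 0\<close> by (simp add: b_def shifted_coeff_length)
  then obtain c where c: "c > 0" "\<And>y. y \<ge> 0 \<Longrightarrow> (\<Sum>j\<le>?m. b a0 j * y ^ j) \<ge> c * (1 + y) ^ ?m"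
    using polynomial_lower_bound[of "b a0" ?m] nz tilde by metis
  have "((\<lambda>a. \<Sum>j\<le>?m. \<bar>b a j - b a0 j\<bar>) \<longlongrightarrow> (\<Sum>j\<le>?m. \<bar>b a0 j - b a0 j\<bar>)) (at a0)"
    unfolding b_def
    by (intro tendsto_intros DERIV_isCont[OF shifted_coeff_has_real_derivative, unfolded isCont_def]) auto
  then have "\<forall>\<^sub>F a in at a0. (\<Sum>j\<le>?m. \<bar>b a j - b a0 j\<bar>) < c"
    by (rule order_tendstoD) (use \<open>c > 0\<close> in simp)
  then show ?thesis
  proof eventually_elim
    case (elim a)
    show ?case
    proof (intro allI impI)
      fix y :: real assume y: "y \<ge> 0"
      have "\<bar>(\<Sum>j\<le>?m. (b a j - b a0 j) * y ^ j)\<bar> \<le> (\<Sum>j\<le>?m. \<bar>b a j - b a0 j\<bar> * (1 + y) ^ ?m)"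
      proof (intro order_trans[OF sum_abs] sum_mono)
        fix j assume "j \<in> {..?m}"
        have "y ^ j \<le> (1 + y) ^ j"
          using y by (intro power_mono) auto
        also have "\<dots> \<le> (1 + y) ^ ?m"
          using y \<open>j \<in> {..?m}\<close> by (intro power_increasing) auto
        finally show "\<bar>(b a j - b a0 j) * y ^ j\<bar> \<le> \<bar>b a j - b a0 j\<bar> * (1 + y) ^ ?m"
          using y by (simp add: abs_mult mult_left_mono)
      qed
      also have "\<dots> = (\<Sum>j\<le>?m. \<bar>b a j - b a0 j\<bar>) * (1 + y) ^ ?m"
        by (simp add: sum_distrib_right)
      also have "\<dots> < c * (1 + y) ^ ?m"
        using elim y by (intro mult_strict_right_mono) auto
      also have "\<dots> \<le> (\<Sum>j\<le>?m. b a0 j * y ^ j)"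
        using c(2) y .
      finally have "\<bar>\<Sum>j\<le>?m. (b a j - b a0 j) * y ^ j\<bar> < (\<Sum>j\<le>?m. b a0 j * y ^ j)" .
      moreover have "(\<Sum>j\<le>?m. (b a j - b a0 j) * y ^ j) = (\<Sum>j\<le>?m. b a j * y ^ j) - (\<Sum>j\<le>?m. b a0 j * y ^ j)"
        by (simp add: left_diff_distrib sum_subtractf)
      ultimately show "shifted_tilde K z n a y > 0"
        by (simp add: tilde)
    qed
  qed
qed

text \<open>In the variable \<open>u = s + a\<close> the transfer function is a combination of the
  \<open>1 / u ^ (n - j)\<close>, which are transforms of powers of \<open>t\<close>; the factor
  \<open>exp (- a * t)\<close> accounts for the shift.\<close>

lemma impulse_response_single_pole:
  assumes "length z < n" "conj_closed z"
  shows "is_impulse_response (Transfer_Function K z (replicate n (- of_real a)))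
    (\<lambda>t. exp (- a * t) * (\<Sum>j<n. shifted_coeff K z a j * t ^ (n - 1 - j) / fact (n - 1 - j)))"
  unfolding is_impulse_response_def has_laplace_transform_def
proof (intro conjI exI allI impI)
  let ?b = "shifted_coeff K z a" and ?H = "Transfer_Function K z (replicate n (- complex_of_real a))"
  show "continuous_on {0..} (\<lambda>t. exp (- a * t) * (\<Sum>j<n. ?b j * t ^ (n - 1 - j) / fact (n - 1 - j)))"
    by (intro continuous_intros) auto
  fix s assume "Re s > - a"
  define u where "u = s + of_real a"
  have "Re u > 0" and [simp]: "u \<noteq> 0"
    using \<open>Re s > - a\<close> by (auto simp: u_def complex_eq_iff)
  have "((\<lambda>t. \<Sum>j<n. of_real (?b j / fact (n - 1 - j)) * (of_real t ^ (n - 1 - j) * exp (- u * of_real t)))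
      has_integral (\<Sum>j<n. of_real (?b j / fact (n - 1 - j)) * (fact (n - 1 - j) / u ^ Suc (n - 1 - j)))) {0..}"
    by (intro has_integral_sum has_integral_mult_right laplace_power \<open>Re u > 0\<close>) auto
  also have "(\<Sum>j<n. of_real (?b j / fact (n - 1 - j)) * (fact (n - 1 - j) / u ^ Suc (n - 1 - j)))
      = (\<Sum>j<n. of_real (?b j) * u ^ j) / u ^ n"
    unfolding sum_divide_distrib
  proof (rule sum.cong)
    fix j assume "j \<in> {..<n}"
    then have "u ^ n = u ^ j * u ^ Suc (n - 1 - j)"
      by (simp flip: power_add power_Suc)
    then show "of_real (?b j / fact (n - 1 - j)) * (fact (n - 1 - j) / u ^ Suc (n - 1 - j)) = of_real (?b j) * u ^ j / u ^ n"
      by simp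
  qed simp
  also have "\<dots> = tf_eval ?H s"
    using poly_B_shift[of K a z u] poly_B_shift_sum[OF assms(1), of K a u]
    by (simp add: tf_eval_def u_def of_real_shifted_coeff[OF assms(2)])
  finally show "((\<lambda>t. exp (- s * of_real t) *
      of_real (exp (- a * t) * (\<Sum>j<n. ?b j * t ^ (n - 1 - j) / fact (n - 1 - j)))) has_integral tf_eval ?H s) {0..}"
  proof (rule has_integral_eq[rotated])
    fix t :: real
    have "exp (- u * of_real t) = exp (- s * of_real t) * of_real (exp (- a * t))"
      by (simp add: u_def algebra_simps flip: exp_of_real exp_add)
    then show "(\<Sum>j<n. of_real (?b j / fact (n - 1 - j)) * (of_real t ^ (n - 1 - j) * exp (- u * of_real t)))
        = exp (- s * of_real t) * of_real (exp (- a * t) * (\<Sum>j<n. ?b j * t ^ (n - 1 - j) / fact (n - 1 - j)))"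
      by (simp add: sum_distrib_left mult_ac)
  qed
qed

text \<open>For \<open>t > 0\<close> the polynomial factor of the impulse response is
  \<open>t ^ (n - 1)\<close> times the tilde polynomial at \<open>1 / t\<close>, so the two share
  their sign.\<close>

lemma externally_positive_single_pole:
  assumes "length z < n" "conj_closed z" and pos: "\<And>y. y \<ge> 0 \<Longrightarrow> shifted_tilde K z n a y \<ge> 0"
  shows "externally_positive (Transfer_Function K z (replicate n (- of_real a)))"
  unfolding externally_positive_def
proof (intro exI conjI allI impI)
  let ?b = "shifted_coeff K z a"
  let ?g = "\<lambda>t. \<Sum>j<n. ?b j * t ^ (n - 1 - j) / fact (n - 1 - j)"
  show "is_impulse_response (Transfer_Function K z (replicate n (- of_real a))) (\<lambda>t. exp (- a * t) * ?g t)"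
    by (rule impulse_response_single_pole) fact+
  have g_pos: "?g t \<ge> 0" if "t > 0" for t
  proof -
    have "?g t = t ^ (n - 1) * shifted_tilde K z n a (1 / t)"
      unfolding shifted_tilde_def sum_distrib_left
    proof (rule sum.cong)
      fix j assume "j \<in> {..<n}"
      then have "t ^ (n - 1) = t ^ j * t ^ (n - 1 - j)"
        by (simp flip: power_add)
      then show "?b j * t ^ (n - 1 - j) / fact (n - 1 - j) = t ^ (n - 1) * (?b j * (1 / t) ^ j / fact (n - 1 - j))"
        using \<open>t > 0\<close> by (simp add: power_divide)
    qed simp
    then show ?thesis
      using pos[of "1 / t"] that by simp
  qed
  \<comment> \<open>The formula in \<open>1 / t\<close> says nothing at \<open>t = 0\<close>;
    continuity from the right carries the sign over.\<close>
  have "?g 0 \<ge> 0"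
  proof (rule tendsto_lowerbound)
    show "(?g \<longlongrightarrow> ?g 0) (at_right 0)"
      by (intro tendsto_intros) auto
    show "\<forall>\<^sub>F t in at_right 0. 0 \<le> ?g t"
      using eventually_at_right_less[of 0] by eventually_elim (rule g_pos)
  qed simp
  then show "exp (- a * t) * ?g t \<ge> 0" if "t \<ge> 0" for t
    using g_pos[of t] that by (cases "t = 0") auto
qed

theorem corollary2:
  fixes m n :: nat and K \<alpha> :: real and z :: "complex list"
  assumes "n > m" and "K > 0" and "\<alpha> \<ge> 0"
    and "length z = m" and "conj_closed z"
    and "\<And>w. w \<in> set z \<Longrightarrow> w \<notin> complex_of_real ` {0..}"
  shows "(\<exists>p. length p = n \<and> conj_closed p \<and> set p \<inter> set z = {} \<and>
            stable_tf (Transfer_Function K z p) \<and>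
            externally_positive (Transfer_Function K z p) \<and>
            decay_rate (Transfer_Function K z p) < - \<alpha>)
     \<longleftrightarrow> \<not> (\<exists>x::real. x \<ge> 0 \<and> poly (poly_tilde n (B_shift K \<alpha> z)) (complex_of_real x) = 0)"
proof
  assume "\<exists>p. length p = n \<and> conj_closed p \<and> set p \<inter> set z = {} \<and>
            stable_tf (Transfer_Function K z p) \<and>
            externally_positive (Transfer_Function K z p) \<and>
            decay_rate (Transfer_Function K z p) < - \<alpha>"
  then obtain p where p: "length p = n" "conj_closed p" "externally_positive (Transfer_Function K z p)"
    and decay: "decay_rate (Transfer_Function K z p) < - \<alpha>"
    by blast
  define \<sigma> where "\<sigma> = decay_rate (Transfer_Function K z p)"
  have \<sigma>: "Re w \<le> \<sigma>" if "w \<in> set p" for w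
    using that by (simp add: \<sigma>_def decay_rate_def)
  have "\<alpha> < - \<sigma>"
    using decay by (simp add: \<sigma>_def)
  \<comment> \<open>All shifts below \<open>- \<sigma>\<close> are treated, an open range containing
    \<alpha>, because the critical point argument needs shifts on both sides of \<alpha>.\<close>
  have nonneg: "shifted_tilde K z n a y \<ge> 0" if "a < - \<sigma>" "y > 0" for a y
  proof -
    have "Re w \<le> - a" if "w \<in> set p" for w
      using \<sigma>[OF that] \<open>a < - \<sigma>\<close> by simp
    then show ?thesis
      using shifted_tilde_nonneg[OF p(3) assms(5) p(2)] \<open>y > 0\<close> assms(1,4) p(1) by simp
  qed
  have "shifted_tilde K z n \<alpha> y \<noteq> 0" if "y \<ge> 0" for y
  proof (cases "y = 0")
    case True
    have "Re w < - \<alpha>" if "w \<in> set p" for w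
      using \<sigma>[OF that] \<open>\<alpha> < - \<sigma>\<close> by simp
    moreover have "p \<noteq> []"
      using p(1) assms(1) by auto
    ultimately show ?thesis
      using shifted_tilde_0_nonzero[OF p(3) _ _ assms(5)] True p(1) assms(2) by simp
  next
    case False
    then show ?thesis
      using shifted_tilde_nonzero[OF nonneg \<open>\<alpha> < - \<sigma>\<close>] that assms(1,2,4) by simp
  qed
  then show "\<not> (\<exists>x::real. x \<ge> 0 \<and> poly (poly_tilde n (B_shift K \<alpha> z)) (complex_of_real x) = 0)"
    by (simp add: poly_tilde_B_shift[OF assms(5)])
next
  assume "\<not> (\<exists>x::real. x \<ge> 0 \<and> poly (poly_tilde n (B_shift K \<alpha> z)) (complex_of_real x) = 0)"
  then have "shifted_tilde K z n \<alpha> y \<noteq> 0" if "y \<ge> 0" for y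
    using that by (simp add: poly_tilde_B_shift[OF assms(5)])
  then have "\<forall>\<^sub>F a in at \<alpha>. \<forall>y\<ge>0. shifted_tilde K z n a y > 0"
    using assms(1,2,4) by (intro eventually_shifted_tilde_pos) auto
  \<comment> \<open>Shifts strictly above \<alpha> are chosen because all poles will be placed at
    \<open>- a\<close>, and \<open>- a < - \<alpha>\<close> is required.\<close>
  then have "\<forall>\<^sub>F a in at_right \<alpha>. \<forall>y\<ge>0. shifted_tilde K z n a y > 0"
    by (rule filter_leD[OF at_le, rotated]) simp
  \<comment> \<open>A pole at \<open>- a\<close> can meet a zero only if their real parts agree,
    which excludes finitely many values of \<open>a\<close>.\<close>
  moreover have "\<forall>\<^sub>F a in at_right \<alpha>. \<forall>w\<in>set z. a \<noteq> - Re w"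
    by (simp add: eventually_ball_finite eventually_neq_at_within)
  moreover have "\<forall>\<^sub>F a in at_right \<alpha>. a > \<alpha>"
    by (rule eventually_at_right_less)
  ultimately have "\<forall>\<^sub>F a in at_right \<alpha>. (\<forall>y\<ge>0. shifted_tilde K z n a y > 0) \<and> (\<forall>w\<in>set z. a \<noteq> - Re w) \<and> a > \<alpha>"
    by eventually_elim blast
  then obtain a where a: "\<And>y. y \<ge> 0 \<Longrightarrow> shifted_tilde K z n a y > 0" "\<And>w. w \<in> set z \<Longrightarrow> a \<noteq> - Re w" "a > \<alpha>"
    using eventually_happens'[OF trivial_limit_at_right_real] by blast
  let ?p = "replicate n (- complex_of_real a)"
  have p: "set ?p = {- complex_of_real a}"
    using assms(1) by simp
  have "externally_positive (Transfer_Function K z ?p)"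
    using assms(1,4,5) a(1) by (intro externally_positive_single_pole) (auto intro: less_imp_le)
  moreover have "conj_closed ?p"
    by (simp add: conj_closed_def)
  moreover have "set ?p \<inter> set z = {}"
    unfolding p using a(2) by force
  moreover have "stable_tf (Transfer_Function K z ?p)"
    unfolding stable_tf_def transfer_function.sel p using assms(3) a(3) by simp
  moreover have "decay_rate (Transfer_Function K z ?p) < - \<alpha>"
    unfolding decay_rate_def transfer_function.sel p using a(3) by simp
  ultimately show "\<exists>p. length p = n \<and> conj_closed p \<and> set p \<inter> set z = {} \<and>
            stable_tf (Transfer_Function K z p) \<and>
            externally_positive (Transfer_Function K z p) \<and>
            decay_rate (Transfer_Function K z p) < - \<alpha>"
    by (intro exI[of _ ?p]) simp
qed

end
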